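(* Let $\lambda/\mu$ be a skew shape, let $m$ be a positive integer, and let $\mathcal{R}(\lambda/\mu)$ be the set of reverse plane partitions of shape $\lambda/\mu$ with entries in $[m]=\{1,\dots,m\}$. For $T\in\mathcal{R}(\lambda/\mu)$ let $\mathrm{wt}(T)=(T(1),\dots,T(m))$, where $T(k)$ is the number of columns of $T$ containing the entry $k$. Then the operators $e_1,\dots,e_{m-1}$ on $\mathcal{R}(\lambda/\mu)$ (together with the operators $f_1,\dots,f_{m-1}$ and the weight $\mathrm{wt}$) satisfy the crystal axioms of type $A_{m-1}$; that is, for all $i\in[m-1]$ and $T,T'\in\mathcal{R}(\lambda/\mu)$: (a) $e_i(T)=T'$ if and only if $f_i(T')=T$; (b) if $e_i(T)\neq 0$ then $\mathrm{wt}(e_i(T))=\mathrm{wt}(T)+\epsilon_i-\epsilon_{i+1}$, where $\epsilon_k$ denotes the $k$-th standard basis vector of $\mathbb{Z}^m$; (c) with $\varepsilon_i(T)=\max\{k\ge 0: e_i^k(T)\neq 0\}$ and $\varphi_i(T)=\max\{k\ge0: f_i^k(T)\neq 0\}$ (both finite), one has $\varphi_i(T)-\varepsilon_i(T)=T(i)-T(i+1)$.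
   Context: A skew shape $\lambda/\mu$ is drawn in matrix coordinates (row index increases downward). A reverse plane partition of shape $\lambda/\mu$ with entries in $[m]$ is a filling of the boxes with elements of $[m]$ weakly increasing along rows (left to right) and columns (top to bottom). Fix $i\in[m-1]$. For a filling $T'$ of $\lambda/\mu$, consider only the boxes with entries $i$ or $i+1$; within this sub-filling, a column is $i$-pure if it contains $i$ but not $i+1$, $(i+1)$-pure if it contains $i+1$ but not $i$, and mixed if it contains both. $T'$ is a benign tableau if its entries weakly increase in columns, the remaining entries (not equal to $i$ or $i+1$) form what they do in a reverse plane partition, and for any two mixed columns $A$ left of $B$, the lowest $i$ in $A$ is not higher than the lowest $i$ in $B$. A descent is a box containing $i+1$ with the box directly to its right containing $i$; let $A$, $A+1$ be the columns of these two boxes. Descent-resolution steps (changing only the $i$/$(i+1)$ entries of columns $A$, $A+1$): if $A$ is mixed and $A+1$ is $i$-pure, make $A$ $i$-pure and $A+1$ mixed, with the lowest $i$ of the new mixed column in the same row as the lowest $i$ of the old mixed column; if $A$ is $(i+1)$-pure and $A+1$ is mixed, make $A$ mixed and $A+1$ $(i+1)$-pure, again keeping the row of the lowest $i$ of the mixed column; if $A$ is $(i+1)$-pure and $A+1$ is $i$-pure, swap $i\leftrightarrow i+1$ in both columns. The descent-resolution algorithm applies such steps to a benign tableau until no descents remain; it terminates in a reverse plane partition, and the result does not depend on the order of the steps. Definition of $e_i$, $f_i$ on $T\in\mathcal{R}(\lambda/\mu)$: in the sub-filling of entries $i,i+1$, label each $i$-pure column by a closing parenthesis and each $(i+1)$-pure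 column by an opening parenthesis (ignore mixed columns), read left to right, and match parentheses in the usual way. $e_i(T)$: take the $(i+1)$-pure column of the leftmost unmatched opening parenthesis (if none, $e_i(T)=0$), replace all its $i+1$'s by $i$'s, and apply the descent-resolution algorithm. $f_i(T)$: take the $i$-pure column of the rightmost unmatched closing parenthesis (if none, $f_i(T)=0$), replace all its $i$'s by $i+1$'s, and apply the descent-resolution algorithm. *)

theory Defs
  imports Main
begin

text \<open>
  Rows and columns are indexed from 0, in matrix coordinates: \<open>(r, c)\<close> is the box in row \<open>r\<close>
  (counted downwards) and column \<open>c\<close> (counted to the right).
\<close>

definition is_partition :: "(nat \<Rightarrow> nat) \<Rightarrow> bool" where
  "is_partition p \<longleftrightarrow> antimono p \<and> finite {r. p r \<noteq> 0}"

definition is_skew_shape :: "(nat \<Rightarrow> nat) \<Rightarrow> (nat \<Rightarrow> nat) \<Rightarrow> bool" where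
  "is_skew_shape lam mu \<longleftrightarrow> is_partition lam \<and> is_partition mu \<and> (\<forall>r. mu r \<le> lam r)"

definition boxes :: "(nat \<Rightarrow> nat) \<Rightarrow> (nat \<Rightarrow> nat) \<Rightarrow> (nat \<times> nat) set" where
  "boxes lam mu = {(r, c). mu r \<le> c \<and> c < lam r}"

text \<open>
  A filling \<open>T\<close> has entry \<open>T r c\<close> in box \<open>(r, c)\<close>. Off the shape it takes the value 0, so that
  equality of fillings is equality of functions and a positive entry only occurs in a box.
\<close>

type_synonym filling = "nat \<Rightarrow> nat \<Rightarrow> nat"

definition fillings :: "(nat \<times> nat) set \<Rightarrow> nat \<Rightarrow> filling set" where
  "fillings D m = {T. (\<forall>r c. (r, c) \<in> D \<longrightarrow> T r c \<in> {1..m}) \<and> (\<forall>r c. (r, c) \<notin> D \<longrightarrow> T r c = 0)}"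

definition columns_weakly_increase :: "(nat \<times> nat) set \<Rightarrow> filling \<Rightarrow> bool" where
  "columns_weakly_increase D T \<longleftrightarrow>
     (\<forall>r r' c. (r, c) \<in> D \<and> (r', c) \<in> D \<and> r \<le> r' \<longrightarrow> T r c \<le> T r' c)"

definition rows_weakly_increase :: "(nat \<times> nat) set \<Rightarrow> filling \<Rightarrow> bool" where
  "rows_weakly_increase D T \<longleftrightarrow>
     (\<forall>r c c'. (r, c) \<in> D \<and> (r, c') \<in> D \<and> c \<le> c' \<longrightarrow> T r c \<le> T r c')"

definition rpps :: "(nat \<times> nat) set \<Rightarrow> nat \<Rightarrow> filling set" where
  "rpps D m = {T \<in> fillings D m. columns_weakly_increase D T \<and> rows_weakly_increase D T}"

definition column_contains :: "filling \<Rightarrow> nat \<Rightarrow> nat \<Rightarrow> bool" where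
  "column_contains T c k \<longleftrightarrow> (\<exists>r. T r c = k)"

text \<open>Meaningful for \<open>k \<ge> 1\<close> only, as 0 is not an entry.\<close>

definition wt :: "filling \<Rightarrow> nat \<Rightarrow> int" where
  "wt T k = int (card {c. column_contains T c k})"

definition unit_vec :: "nat \<Rightarrow> nat \<Rightarrow> int" where
  "unit_vec k = (\<lambda>j. if j = k then 1 else 0)"

definition low_pure :: "nat \<Rightarrow> filling \<Rightarrow> nat \<Rightarrow> bool" where
  "low_pure i T c \<longleftrightarrow> column_contains T c i \<and> \<not> column_contains T c (i + 1)"

definition high_pure :: "nat \<Rightarrow> filling \<Rightarrow> nat \<Rightarrow> bool" where
  "high_pure i T c \<longleftrightarrow> column_contains T c (i + 1) \<and> \<not> column_contains T c i"

definition mixed :: "nat \<Rightarrow> filling \<Rightarrow> nat \<Rightarrow> bool" where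
  "mixed i T c \<longleftrightarrow> column_contains T c i \<and> column_contains T c (i + 1)"

text \<open>Row of the lowest \<open>i\<close> in column \<open>c\<close>; lower means larger row index.\<close>

definition lowest :: "nat \<Rightarrow> filling \<Rightarrow> nat \<Rightarrow> nat" where
  "lowest i T c = Max {r. T r c = i}"

text \<open>
  In a benign tableau the row inequalities of a reverse plane partition may only fail between
  two entries both of which lie in \<open>{i, i + 1}\<close>.
\<close>

definition benign :: "(nat \<times> nat) set \<Rightarrow> nat \<Rightarrow> nat \<Rightarrow> filling \<Rightarrow> bool" where
  "benign D m i T \<longleftrightarrow>
     T \<in> fillings D m \<and>
     columns_weakly_increase D T \<and>
     (\<forall>r c c'. (r, c) \<in> D \<and> (r, c') \<in> D \<and> c \<le> c' \<and> \<not> (T r c \<in> {i, i + 1} \<and> T r c' \<in> {i, i + 1})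
        \<longrightarrow> T r c \<le> T r c') \<and>
     (\<forall>A B. A < B \<and> mixed i T A \<and> mixed i T B \<longrightarrow> lowest i T B \<le> lowest i T A)"

text \<open>
  Among the entries \<open>i\<close>, \<open>i + 1\<close> of column \<open>c\<close>, those in rows from \<open>U\<close> become \<open>i\<close> and the others
  become \<open>i + 1\<close>.
\<close>

definition recolour :: "nat \<Rightarrow> nat \<Rightarrow> nat set \<Rightarrow> filling \<Rightarrow> filling" where
  "recolour i c U T =
     (\<lambda>x y. if y = c \<and> T x y \<in> {i, i + 1} then (if x \<in> U then i else i + 1) else T x y)"

definition descent :: "nat \<Rightarrow> filling \<Rightarrow> nat \<Rightarrow> nat \<Rightarrow> bool" where
  "descent i T r c \<longleftrightarrow> T r c = i + 1 \<and> T r (c + 1) = i"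

inductive resolution_step :: "(nat \<times> nat) set \<Rightarrow> nat \<Rightarrow> nat \<Rightarrow> filling \<Rightarrow> filling \<Rightarrow> bool"
  for D m i where
  mixed_low:
    "\<lbrakk>benign D m i T; descent i T r A; mixed i T A; low_pure i T (A + 1)\<rbrakk> \<Longrightarrow>
     resolution_step D m i T
       (recolour i A UNIV (recolour i (A + 1) {..lowest i T A} T))"
| high_mixed:
    "\<lbrakk>benign D m i T; descent i T r A; high_pure i T A; mixed i T (A + 1)\<rbrakk> \<Longrightarrow>
     resolution_step D m i T
       (recolour i A {..lowest i T (A + 1)} (recolour i (A + 1) {} T))"
| high_low:
    "\<lbrakk>benign D m i T; descent i T r A; high_pure i T A; low_pure i T (A + 1)\<rbrakk> \<Longrightarrow>
     resolution_step D m i T (recolour i A UNIV (recolour i (A + 1) {} T))"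

text \<open>
  The definite description is justified by the fact that, from a benign tableau, the algorithm
  terminates and its result does not depend on the order of the steps.
\<close>

definition descent_resolution :: "(nat \<times> nat) set \<Rightarrow> nat \<Rightarrow> nat \<Rightarrow> filling \<Rightarrow> filling" where
  "descent_resolution D m i T =
     (THE T'. (resolution_step D m i)\<^sup>*\<^sup>* T T' \<and> \<not> (\<exists>r c. descent i T' r c))"

text \<open>
  Parenthesis matching: \<open>(i+1)\<close>-pure columns are opening, \<open>i\<close>-pure columns closing parentheses.
  An opening parenthesis is matched with a closing one to its right once all parentheses strictly
  between the two are matched among themselves.
\<close>

inductive matched :: "nat \<Rightarrow> filling \<Rightarrow> nat \<Rightarrow> nat \<Rightarrow> bool" for i T where
  "\<lbrakk>high_pure i T a; low_pure i T b; a < b;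
    \<forall>c. a < c \<and> c < b \<and> (high_pure i T c \<or> low_pure i T c) \<longrightarrow>
        (\<exists>d. a < d \<and> d < b \<and> (matched i T c d \<or> matched i T d c))\<rbrakk> \<Longrightarrow>
   matched i T a b"

definition unmatched_opening :: "nat \<Rightarrow> filling \<Rightarrow> nat set" where
  "unmatched_opening i T = {a. high_pure i T a \<and> \<not> (\<exists>b. matched i T a b)}"

definition unmatched_closing :: "nat \<Rightarrow> filling \<Rightarrow> nat set" where
  "unmatched_closing i T = {b. low_pure i T b \<and> \<not> (\<exists>a. matched i T a b)}"

text \<open>The value \<open>0\<close> of the crystal operators is rendered as \<open>None\<close>.\<close>

definition e_op :: "(nat \<times> nat) set \<Rightarrow> nat \<Rightarrow> nat \<Rightarrow> filling \<Rightarrow> filling option" where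
  "e_op D m i T =
     (if unmatched_opening i T = {} then None
      else Some (descent_resolution D m i (recolour i (Min (unmatched_opening i T)) UNIV T)))"

definition f_op :: "(nat \<times> nat) set \<Rightarrow> nat \<Rightarrow> nat \<Rightarrow> filling \<Rightarrow> filling option" where
  "f_op D m i T =
     (if unmatched_closing i T = {} then None
      else Some (descent_resolution D m i (recolour i (Max (unmatched_closing i T)) {} T)))"

definition iterate :: "('a \<Rightarrow> 'a option) \<Rightarrow> nat \<Rightarrow> 'a \<Rightarrow> 'a option" where
  "iterate g k x = ((\<lambda>y. Option.bind y g) ^^ k) (Some x)"

text \<open>The maximal \<open>k\<close> with \<open>g\<^sup>k(x) \<noteq> 0\<close>; only meaningful when the set is finite.\<close>

definition max_iterate :: "('a \<Rightarrow> 'a option) \<Rightarrow> 'a \<Rightarrow> nat" where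
  "max_iterate g x = Max {k. iterate g k x \<noteq> None}"

end

theory Submission
  imports Defs
begin

text \<open>
  Read the columns from left to right and let the height rise by one at every opening and fall by
  one at every closing parenthesis. The column changed by \<open>e\<^sub>i\<close> is where the height is minimal for
  the last time, the one changed by \<open>f\<^sub>i\<close> is just before it is minimal for the first time. After
  \<open>e\<^sub>i\<close> has flipped its column, the only possible resolution steps move the new \<open>i\<close>-pure column to the
  left past mixed columns, so the process is deterministic and no general confluence argument is
  needed. Each such step, with the travelling column flipped back, is undone by a resolution step
  of the process started by \<open>f\<^sub>i\<close>, and conversely; hence \<open>e\<^sub>i\<close> and \<open>f\<^sub>i\<close> are mutually inverse. Moreover
  \<open>e\<^sub>i\<close> lowers the minimum of the height by one and its final value by two, from which the numbers of
  possible iterations are read off.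
\<close>

section \<open>Parenthesis matching and heights\<close>

text \<open>Mixed columns and columns with neither entry get 0, so the height passes over them just
  as the matching does.\<close>

definition sign :: "nat \<Rightarrow> filling \<Rightarrow> nat \<Rightarrow> int" where
  "sign i T c = of_bool (column_contains T c (i + 1)) - of_bool (column_contains T c i)"

definition height :: "nat \<Rightarrow> filling \<Rightarrow> nat \<Rightarrow> int" where
  "height i T x = (\<Sum>c<x. sign i T c)"

lemma height_0 [simp]: "height i T 0 = 0"
  by (simp add: height_def)

lemma height_Suc [simp]: "height i T (Suc x) = height i T x + sign i T x"
  by (simp add: height_def)

lemma sign_eq_1_iff: "sign i T c = 1 \<longleftrightarrow> high_pure i T c"
  by (auto simp: sign_def high_pure_def)

lemma sign_eq_minus_1_iff: "sign i T c = - 1 \<longleftrightarrow> low_pure i T c"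
  by (auto simp: sign_def low_pure_def)

lemma sign_high [simp]: "high_pure i T c \<Longrightarrow> sign i T c = 1"
  by (simp add: sign_eq_1_iff)

lemma sign_low [simp]: "low_pure i T c \<Longrightarrow> sign i T c = - 1"
  by (simp add: sign_eq_minus_1_iff)

lemma sign_mixed [simp]: "mixed i T c \<Longrightarrow> sign i T c = 0"
  by (simp add: sign_def mixed_def)

lemma high_if_height_less: "height i T x < height i T (Suc x) \<Longrightarrow> high_pure i T x"
  by (auto simp: sign_def high_pure_def split: if_splits)

lemma low_if_height_less: "height i T (Suc x) < height i T x \<Longrightarrow> low_pure i T x"
  by (auto simp: sign_def low_pure_def of_bool_def split: if_splits)

lemma not_high_and_low: "high_pure i T c \<Longrightarrow> low_pure i T c \<Longrightarrow> False"
  by (simp add: high_pure_def low_pure_def)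

text \<open>Heights change by at most one per column. So at the first position after
  \<open>a\<close> whose height is not above that of \<open>a\<close>, the two heights agree, and
  the column just crossed is closing. It will be the partner of \<open>a\<close>.\<close>

lemma first_return:
  assumes "high_pure i T a" "a < b" "height i T b \<le> height i T a"
  obtains d where "a < d" "d < b" "low_pure i T d" "height i T (Suc d) = height i T a"
    "\<And>x. a < x \<Longrightarrow> x \<le> d \<Longrightarrow> height i T a < height i T x"
proof -
  define e where "e = (LEAST x. a < x \<and> height i T x \<le> height i T a)"
  have e: "a < e" "height i T e \<le> height i T a"
    unfolding e_def by (rule LeastI2[of _ b]; use assms in simp)+
  have "e \<le> b"
    unfolding e_def by (rule Least_le) (use assms in simp)
  have before: "height i T a < height i T x" if "a < x" "x < e" for x
    using not_less_Least[of x "\<lambda>x. a < x \<and> height i T x \<le> height i T a"] that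
    by (auto simp: e_def)
  obtain d where d: "e = Suc d"
    using e(1) by (cases e) auto
  have "d \<noteq> a"
    using e(2) assms(1) d by auto
  then have "a < d"
    using e(1) d by simp
  then have "height i T a < height i T d"
    using before d by simp
  then have low: "low_pure i T d"
    using e(2) d by (intro low_if_height_less) simp
  have "height i T (Suc d) = height i T a"
    using low e(2) d \<open>height i T a < height i T d\<close> by simp
  then show thesis
    using that[of d] \<open>a < d\<close> \<open>e \<le> b\<close> d low before by simp
qed

text \<open>Mirror image of \<open>first_return\<close>, with the greatest instead of the least
  position. The bound \<open>x\<close> serves to keep the partner of \<open>c\<close> inside a given
  interval.\<close>

lemma last_departure:
  assumes "low_pure i T c" "x \<le> c" "height i T x \<le> height i T (Suc c)"
  obtains d where "x \<le> d" "d < c" "high_pure i T d" "height i T d = height i T (Suc c)"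
    "\<And>y. d < y \<Longrightarrow> y \<le> c \<Longrightarrow> height i T d < height i T y"
proof -
  define P where "P y \<longleftrightarrow> y \<le> c \<and> height i T y \<le> height i T (Suc c)" for y
  define d where "d = (GREATEST y. P y)"
  have bound: "\<And>y. P y \<Longrightarrow> y \<le> c"
    by (simp add: P_def)
  have Px: "P x"
    using assms by (simp add: P_def)
  have Pd: "P d"
    unfolding d_def using Px bound by (rule GreatestI_nat)
  have "x \<le> d"
    unfolding d_def using Px bound by (rule Greatest_le_nat)
  have after: "height i T (Suc c) < height i T y" if "d < y" "y \<le> c" for y
  proof (rule ccontr)
    assume "\<not> height i T (Suc c) < height i T y"
    then have "P y"
      using that by (simp add: P_def)
    then have "y \<le> d"
      unfolding d_def using bound by (rule Greatest_le_nat)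
    with that show False by simp
  qed
  have "d \<noteq> c"
    using Pd assms(1) by (auto simp: P_def)
  then have "d < c"
    using Pd by (simp add: P_def)
  then have less: "height i T (Suc c) < height i T (Suc d)"
    by (intro after) auto
  then have high: "high_pure i T d"
    using Pd by (intro high_if_height_less) (simp add: P_def)
  have "height i T d = height i T (Suc c)"
    using high less Pd by (simp add: P_def)
  then show thesis
    using that[of d] \<open>x \<le> d\<close> \<open>d < c\<close> high after by simp
qed

text \<open>The partners of the interior parentheses keep the interior from dipping below its start
  and, read from the right, below its end; hence start and end are level.\<close>

lemma matched_height:
  assumes "matched i T a b"
  shows "high_pure i T a \<and> low_pure i T b \<and> a < b \<and> height i T (Suc b) = height i T a \<and>
    (\<forall>x. a < x \<and> x \<le> b \<longrightarrow> height i T a < height i T x)"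
  using assms
proof (induction rule: matched.induct)
  case (1 a b)
  have start: "height i T (Suc a) = height i T a + 1"
    using 1 by simp
  \<comment> \<open>At a dip \<open>x\<close> the last column \<open>c\<close> is closing, and its
    interior partner \<open>d\<close> begins at the height reached after \<open>c\<close>; so
    \<open>d\<close> would be an earlier dip, against the induction hypothesis.\<close>
  have above: "height i T (Suc a) \<le> height i T x" if "a < x" "x \<le> b" for x
    using that
  proof (induction x rule: less_induct)
    case (less x)
    show ?case
    proof (rule ccontr)
      assume neg: "\<not> ?thesis"
      then have "x \<noteq> Suc a"
        by auto
      then obtain c where c: "x = Suc c" "a < c"
        using less.prems by (cases x) auto
      then have "height i T (Suc a) \<le> height i T c"
        using less by simp
      then have low: "low_pure i T c"
        using neg c by (intro low_if_height_less) simp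
      moreover have "c < b" "\<not> high_pure i T c"
        using c less.prems low not_high_and_low by auto
      ultimately obtain d where "a < d" "d < b" "height i T (Suc c) = height i T d" "d < c"
        using 1(4)[rule_format, of c] c by blast
      then show False
        using less c neg by auto
    qed
  qed
  \<comment> \<open>The same from right to left: an opening \<open>x\<close> below the level of
    \<open>b\<close> passes its height on to the position after its partner.\<close>
  have below: "height i T b \<le> height i T x" if "a < x" "x \<le> b" for x
    using that
  proof (induction "b - x" arbitrary: x rule: less_induct)
    case less
    show ?case
    proof (rule ccontr)
      assume neg: "\<not> ?thesis"
      then have x: "x < b"
        using less.prems by (cases "x = b") auto
      then have "height i T b \<le> height i T (Suc x)"
        using less.prems by (intro less.hyps) auto
      then have high: "high_pure i T x"
        using neg by (intro high_if_height_less) simp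
      then have "\<not> low_pure i T x"
        using not_high_and_low by blast
      then obtain d where d: "x < d" "d < b" "height i T (Suc d) = height i T x"
        using 1(4)[rule_format, of x] high x less.prems by blast
      then have "height i T b \<le> height i T (Suc d)"
        using less.prems by (intro less.hyps) auto
      then show False
        using neg d by simp
    qed
  qed
  have "height i T b = height i T (Suc a)"
    using above[of b] below[of "Suc a"] 1(3) by simp
  then show ?case
    using 1 start above by force
qed

text \<open>Every interior parenthesis gets a partner from \<open>first_return\<close> or
  \<open>last_departure\<close>. These pairs span shorter intervals, so induction on
  \<open>b - a\<close> applies, and the rule for \<open>matched\<close> closes the outer
  pair.\<close>

lemma matched_if_height:
  assumes "high_pure i T a" "low_pure i T b" "a < b" "height i T (Suc b) = height i T a"
    and "\<And>x. a < x \<Longrightarrow> x \<le> b \<Longrightarrow> height i T a < height i T x"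
  shows "matched i T a b"
  using assms
proof (induction "b - a" arbitrary: a b rule: less_induct)
  case less
  have hb: "height i T b = height i T a + 1"
    using less.prems by simp
  have "\<exists>d. a < d \<and> d < b \<and> (matched i T c d \<or> matched i T d c)"
    if c: "a < c" "c < b" "high_pure i T c \<or> low_pure i T c" for c
    using c(3)
  proof
    assume high: "high_pure i T c"
    \<comment> \<open>Interior heights are at least \<open>height i T a + 1\<close>, the height at
      \<open>b\<close>, so the return happens before \<open>b\<close>.\<close>
    have "height i T b \<le> height i T c"
      using hb less.prems(5)[of c] c by simp
    then obtain d where d: "c < d" "d < b" "low_pure i T d" "height i T (Suc d) = height i T c"
      "\<And>x. c < x \<Longrightarrow> x \<le> d \<Longrightarrow> height i T c < height i T x"
      using first_return[OF high c(2)] by metis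
    then have "matched i T c d"
      using c by (intro less.hyps high) (auto simp del: height_Suc)
    then show ?thesis
      using d c by (meson less_trans)
  next
    assume low: "low_pure i T c"
    \<comment> \<open>Starting the search at \<open>Suc a\<close> instead of \<open>a\<close> keeps
      the partner strictly inside.\<close>
    have "height i T (Suc a) \<le> height i T (Suc c)"
      using less.prems(1) less.prems(5)[of "Suc c"] c by simp
    then obtain d where d: "Suc a \<le> d" "d < c" "high_pure i T d"
      "height i T d = height i T (Suc c)"
      "\<And>y. d < y \<Longrightarrow> y \<le> c \<Longrightarrow> height i T d < height i T y"
      using last_departure[OF low, of "Suc a"] c by (metis Suc_leI)
    then have "matched i T d c"
      using c by (intro less.hyps low) (auto simp del: height_Suc)
    then show ?thesis
      using d c by (meson Suc_le_lessD less_trans)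
  qed
  then show ?case
    by (intro matched.intros less.prems) auto
qed

text \<open>A partner brings the height back to its value at \<open>a\<close>; conversely, the first
  return to this value supplies a partner.\<close>

lemma unmatched_opening_eq:
  "unmatched_opening i T = {a. high_pure i T a \<and> (\<forall>x>a. height i T a < height i T x)}"
proof (intro set_eqI iffI)
  fix a assume "a \<in> unmatched_opening i T"
  then have a: "high_pure i T a" "\<And>b. \<not> matched i T a b"
    by (auto simp: unmatched_opening_def)
  have "height i T a < height i T x" if x: "a < x" for x
  proof (rule ccontr)
    assume "\<not> ?thesis"
    then obtain d where "matched i T a d"
      using first_return[OF a(1) x] matched_if_height[OF a(1)] by (metis not_less)
    with a show False by blast
  qed
  with a show "a \<in> {a. high_pure i T a \<and> (\<forall>x>a. height i T a < height i T x)}"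
    by blast
next
  fix a assume a: "a \<in> {a. high_pure i T a \<and> (\<forall>x>a. height i T a < height i T x)}"
  have False if "matched i T a b" for b
  proof -
    have "a < Suc b" "height i T (Suc b) = height i T a"
      using matched_height[OF that] by auto
    with a show False by fastforce
  qed
  with a show "a \<in> unmatched_opening i T"
    by (auto simp: unmatched_opening_def)
qed

lemma unmatched_closing_eq:
  "unmatched_closing i T = {b. low_pure i T b \<and> (\<forall>x\<le>b. height i T (Suc b) < height i T x)}"
proof (intro set_eqI iffI)
  fix b assume "b \<in> unmatched_closing i T"
  then have b: "low_pure i T b" "\<And>a. \<not> matched i T a b"
    by (auto simp: unmatched_closing_def)
  have "height i T (Suc b) < height i T x" if x: "x \<le> b" for x
  proof (rule ccontr)
    assume "\<not> ?thesis"
    then obtain d where "matched i T d b"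
      using last_departure[OF b(1) x] matched_if_height[OF _ b(1)] by (metis not_less)
    with b show False by blast
  qed
  with b show "b \<in> {b. low_pure i T b \<and> (\<forall>x\<le>b. height i T (Suc b) < height i T x)}"
    by blast
next
  fix b assume b: "b \<in> {b. low_pure i T b \<and> (\<forall>x\<le>b. height i T (Suc b) < height i T x)}"
  have False if "matched i T a b" for a
  proof -
    have "a \<le> b" "height i T (Suc b) = height i T a"
      using matched_height[OF that] by auto
    with b show False by fastforce
  qed
  with b show "b \<in> unmatched_closing i T"
    by (auto simp: unmatched_closing_def)
qed

text \<open>
  For an \<open>(i + 1)\<close>-pure column \<open>c\<close> this says that \<open>c\<close> is the leftmost unmatched opening
  parenthesis, for an \<open>i\<close>-pure one that it is the rightmost unmatched closing parenthesis.
  Flipping the column preserves the condition, so it exchanges the two cases.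
\<close>

definition pivot :: "nat \<Rightarrow> filling \<Rightarrow> nat \<Rightarrow> bool" where
  "pivot i T c \<longleftrightarrow>
     (\<forall>x\<le>c. height i T c \<le> height i T x) \<and> (\<forall>x>c. height i T (Suc c) \<le> height i T x)"

definition pure_columns :: "nat \<Rightarrow> filling \<Rightarrow> nat set" where
  "pure_columns i T = {c. sign i T c \<noteq> 0}"

section \<open>Pivots and the extreme unmatched parentheses\<close>

lemma finite_unmatched:
  assumes "finite (pure_columns i T)"
  shows "finite (unmatched_opening i T)" "finite (unmatched_closing i T)"
  by (rule finite_subset[OF _ assms];
      auto simp: pure_columns_def unmatched_opening_def unmatched_closing_def)+

text \<open>The rightmost position before \<open>c\<close> that is lower than \<open>c\<close> would
  be lower than everything after it, hence an unmatched opening to the left of the leftmost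
  one.\<close>

lemma Min_unmatched_opening:
  assumes "finite (pure_columns i T)" "unmatched_opening i T \<noteq> {}"
  defines "c \<equiv> Min (unmatched_opening i T)"
  shows "high_pure i T c" "pivot i T c"
proof -
  have c: "c \<in> unmatched_opening i T"
    unfolding c_def using assms finite_unmatched by simp
  then show high: "high_pure i T c"
    by (simp add: unmatched_opening_def)
  have after: "height i T c < height i T x" if "c < x" for x
    using c that by (simp add: unmatched_opening_eq)
  have before: "height i T c \<le> height i T x" if "x \<le> c" for x
    using that
  proof (induction "c - x" arbitrary: x rule: less_induct)
    case less
    show ?case
    proof (rule ccontr)
      assume neg: "\<not> ?thesis"
      then have "x < c"
        using less.prems by (cases "x = c") auto
      have later: "height i T c \<le> height i T y" if "x < y" for y
        using that less.hyps[of y] \<open>x < c\<close> after[of y] by (cases "y \<le> c") auto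
      have "high_pure i T x"
        using neg later[of "Suc x"] by (intro high_if_height_less) simp
      then have "x \<in> unmatched_opening i T"
        using neg later by (force simp: unmatched_opening_eq)
      then have "c \<le> x"
        unfolding c_def using assms finite_unmatched by simp
      with \<open>x < c\<close> show False by simp
    qed
  qed
  show "pivot i T c"
    using before after high by (force simp: pivot_def)
qed

text \<open>The first position lower than the one after \<open>b\<close> would complete an unmatched
  closing parenthesis to the right of the rightmost one.\<close>

lemma Max_unmatched_closing:
  assumes "finite (pure_columns i T)" "unmatched_closing i T \<noteq> {}"
  defines "b \<equiv> Max (unmatched_closing i T)"
  shows "low_pure i T b" "pivot i T b"
proof -
  have b: "b \<in> unmatched_closing i T"
    unfolding b_def using assms finite_unmatched by simp
  then show low: "low_pure i T b"
    by (simp add: unmatched_closing_def)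
  have before: "height i T (Suc b) < height i T x" if "x \<le> b" for x
    using b that low by (simp add: unmatched_closing_eq)
  have after: "height i T (Suc b) \<le> height i T x" for x
  proof (induction x rule: less_induct)
    case (less x)
    show ?case
    proof (rule ccontr)
      assume neg: "\<not> ?thesis"
      then have "Suc b < x"
        using before[of x] by (cases "x \<le> b"; cases "x = Suc b") auto
      then obtain a where a: "x = Suc a" "b < a"
        by (cases x) auto
      have "low_pure i T a"
        using neg less[of a] a by (intro low_if_height_less) simp
      moreover have "height i T (Suc a) < height i T y" if "y \<le> a" for y
        using less[of y] neg a that by simp
      ultimately have "a \<in> unmatched_closing i T"
        by (simp add: unmatched_closing_eq)
      then have "a \<le> b"
        unfolding b_def using assms finite_unmatched by simp
      with a show False by simp
    qed
  qed
  show "pivot i T b"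
    using before after low by (force simp: pivot_def)
qed

text \<open>An unmatched opening to the left of \<open>c\<close> would be strictly lower than
  \<open>c\<close>. Together with \<open>pivot_low\<close> this identifies, after resolution, the
  column which the inverse operator selects.\<close>

lemma pivot_high:
  assumes "finite (pure_columns i T)" "high_pure i T c" "pivot i T c"
  shows "unmatched_opening i T \<noteq> {}" "Min (unmatched_opening i T) = c"
proof -
  have c: "c \<in> unmatched_opening i T"
    using assms by (force simp: unmatched_opening_eq pivot_def)
  have "c \<le> a" if "a \<in> unmatched_opening i T" for a
    using that assms(3) by (force simp: unmatched_opening_eq pivot_def not_less[symmetric])
  with c show "Min (unmatched_opening i T) = c"
    using finite_unmatched assms(1) by (intro Min_eqI) auto
  show "unmatched_opening i T \<noteq> {}"
    using c by blast
qed

lemma pivot_low: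
  assumes "finite (pure_columns i T)" "low_pure i T b" "pivot i T b"
  shows "unmatched_closing i T \<noteq> {}" "Max (unmatched_closing i T) = b"
proof -
  have b: "b \<in> unmatched_closing i T"
    using assms by (force simp: unmatched_closing_eq pivot_def)
  have "a \<le> b" if "a \<in> unmatched_closing i T" for a
  proof (rule ccontr)
    assume "\<not> a \<le> b"
    then have "height i T (Suc a) < height i T (Suc b)" "height i T (Suc b) \<le> height i T (Suc a)"
      using that assms(3) by (auto simp only: unmatched_closing_eq pivot_def)
    then show False by simp
  qed
  with b show "Max (unmatched_closing i T) = b"
    using finite_unmatched assms(1) by (intro Max_eqI) auto
  show "unmatched_closing i T \<noteq> {}"
    using b by blast
qed

section \<open>The minimal and the final height\<close>

lemma height_eventually:
  assumes "\<And>c. c \<in> pure_columns i T \<Longrightarrow> c < N" "N \<le> x"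
  shows "height i T x = height i T N"
  using assms(2)
proof (induction x rule: dec_induct)
  case (step x)
  then show ?case
    using assms(1)[of x] by (force simp: pure_columns_def)
qed simp

lemma pure_columns_bound:
  assumes "finite (pure_columns i T)"
  obtains N where "\<And>c. c \<in> pure_columns i T \<Longrightarrow> c < N"
  using assms by (metis finite_nat_set_iff_bounded)

lemma finite_range_height:
  assumes "finite (pure_columns i T)"
  shows "finite (range (height i T))"
proof -
  obtain N where N: "\<And>c. c \<in> pure_columns i T \<Longrightarrow> c < N"
    using pure_columns_bound[OF assms] by blast
  have "range (height i T) \<subseteq> height i T ` {..N}"
  proof
    fix h assume "h \<in> range (height i T)"
    then obtain x where x: "h = height i T x" by blast
    have "h = height i T (min x N)"
      using height_eventually[of i T N x] N x by (cases "x \<le> N") (auto simp: min_def)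
    then show "h \<in> height i T ` {..N}" by simp
  qed
  then show ?thesis
    by (rule finite_subset) simp
qed

text \<open>
  On reverse plane partitions \<open>\<phi>\<^sub>i = - ebb\<close>, and \<open>\<epsilon>\<^sub>i\<close> is the final height minus \<open>ebb\<close>.
\<close>

definition ebb :: "nat \<Rightarrow> filling \<Rightarrow> int" where
  "ebb i T = Min (range (height i T))"

lemma ebb_le: "finite (pure_columns i T) \<Longrightarrow> ebb i T \<le> height i T x"
  by (simp add: ebb_def finite_range_height)

lemma ebb_eqI:
  "finite (pure_columns i T) \<Longrightarrow> (\<And>y. height i T x \<le> height i T y) \<Longrightarrow> ebb i T = height i T x"
  unfolding ebb_def by (intro Min_eqI finite_range_height) auto

lemma ebb_high:
  assumes "finite (pure_columns i T)" "high_pure i T c" "pivot i T c"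
  shows "ebb i T = height i T c"
proof (rule ebb_eqI[OF assms(1)])
  show "height i T c \<le> height i T y" for y
  proof (cases "y \<le> c")
    case False
    then have "height i T (Suc c) \<le> height i T y"
      using assms(3) by (simp add: pivot_def)
    then show ?thesis
      using assms(2) by simp
  qed (use assms(3) in \<open>simp add: pivot_def\<close>)
qed

lemma ebb_low:
  assumes "finite (pure_columns i T)" "low_pure i T c" "pivot i T c"
  shows "ebb i T = height i T c - 1"
proof -
  have "ebb i T = height i T (Suc c)"
  proof (rule ebb_eqI[OF assms(1)])
    show "height i T (Suc c) \<le> height i T y" for y
      using assms(2,3) by (cases "y \<le> c") (force simp: pivot_def)+
  qed
  then show ?thesis
    using assms(2) by simp
qed

text \<open>The first position of negative height would complete an unmatched closing parenthesis,
  so the minimum is the initial height.\<close>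

lemma ebb_no_closing:
  assumes "finite (pure_columns i T)" "unmatched_closing i T = {}"
  shows "ebb i T = 0"
proof -
  have "0 \<le> height i T x" for x
  proof (induction x rule: less_induct)
    case (less x)
    show ?case
    proof (rule ccontr)
      assume neg: "\<not> ?thesis"
      then obtain a where a: "x = Suc a"
        by (cases x) auto
      have "low_pure i T a"
        using neg less[of a] a by (intro low_if_height_less) simp
      moreover have "height i T (Suc a) < height i T y" if "y \<le> a" for y
        using less[of y] neg a that by simp
      ultimately show False
        using assms(2) by (auto simp: unmatched_closing_eq)
    qed
  qed
  then show ?thesis
    using ebb_eqI[OF assms(1), of 0] by simp
qed

text \<open>The last position below the final height would be an unmatched opening
  parenthesis.\<close>

lemma ebb_no_opening:
  assumes "finite (pure_columns i T)" "unmatched_opening i T = {}"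
    and N: "\<And>c. c \<in> pure_columns i T \<Longrightarrow> c < N"
  shows "ebb i T = height i T N"
proof (rule ebb_eqI[OF assms(1)])
  show "height i T N \<le> height i T x" for x
  proof (induction "N - x" arbitrary: x rule: less_induct)
    case less
    show ?case
    proof (rule ccontr)
      assume neg: "\<not> ?thesis"
      then have "x < N"
        using height_eventually[of i T N x] N by (cases "x < N") auto
      have later: "height i T N \<le> height i T y" if "x < y" for y
        using that less[of y] \<open>x < N\<close> by simp
      have "high_pure i T x"
        using neg later[of "Suc x"] by (intro high_if_height_less) simp
      then show False
        using neg later assms(2) by (force simp: unmatched_opening_eq)
    qed
  qed
qed

text \<open>Mixed columns are counted by both weights and cancel, which is why the pure columns
  alone give the difference of the weights.\<close>

lemma height_total:
  assumes "\<And>c. column_contains T c i \<Longrightarrow> c < N" "\<And>c. column_contains T c (i + 1) \<Longrightarrow> c < N"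
  shows "height i T N = wt T (i + 1) - wt T i"
proof -
  have "{..<N} \<inter> {c. column_contains T c k} = {c. column_contains T c k}" if "k \<in> {i, i + 1}" for k
    using assms that by auto
  then show ?thesis
    by (simp add: height_def sign_def wt_def sum_subtractf sum.If_cases of_bool_def)
qed

section \<open>Heights under local changes of sign\<close>

lemma height_recolour:
  assumes "\<And>c. c \<noteq> j \<Longrightarrow> sign i V' c = sign i V c"
  shows "height i V' x = height i V x + (if j < x then sign i V' j - sign i V j else 0)"
  using assms by (induction x) (auto simp: less_Suc_eq)

text \<open>Exchanging two adjacent summands affects only the partial sum that ends between them.
  This is the effect of one resolution step on the heights.\<close>

lemma height_swap:
  assumes "\<And>c. c \<noteq> j \<Longrightarrow> c \<noteq> Suc j \<Longrightarrow> sign i V' c = sign i V c"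
    and "sign i V' j = sign i V (Suc j)" "sign i V' (Suc j) = sign i V j"
  shows "height i V' x = height i V x + (if x = Suc j then sign i V' j - sign i V j else 0)"
proof (induction x)
  case (Suc x)
  show ?case
    using Suc assms by (cases "x = j"; cases "x = Suc j") auto
qed simp

section \<open>Iterates and normal forms\<close>

lemma iterate_0 [simp]: "iterate g 0 x = Some x"
  by (simp add: iterate_def)

lemma iterate_Suc: "iterate g (Suc k) x = Option.bind (g x) (iterate g k)"
proof -
  have "iterate g (Suc k) x = ((\<lambda>y. Option.bind y g) ^^ k) (g x)"
    by (simp add: iterate_def funpow_Suc_right del: funpow.simps)
  also have "\<dots> = Option.bind (g x) (iterate g k)"
  proof (cases "g x")
    case None
    then show ?thesis by (induction k) auto
  qed (simp add: iterate_def)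
  finally show ?thesis .
qed

text \<open>The rank falls by exactly one with each application and is 0 where \<open>g\<close>
  stops, so it counts the possible applications.\<close>

lemma iterate_domain:
  assumes "\<And>x y. x \<in> R \<Longrightarrow> g x = Some y \<Longrightarrow> y \<in> R \<and> rk x = Suc (rk y)"
    and "\<And>x. x \<in> R \<Longrightarrow> g x = None \<Longrightarrow> rk x = 0"
    and "x \<in> R"
  shows "{k. iterate g k x \<noteq> None} = {..rk x}"
proof -
  have "iterate g k x \<noteq> None \<longleftrightarrow> k \<le> rk x" for k
    using assms(3)
  proof (induction k arbitrary: x)
    case (Suc k)
    show ?case
    proof (cases "g x")
      case None
      then show ?thesis
        using assms(2) Suc.prems by (simp add: iterate_Suc)
    next
      case (Some y)
      then show ?thesis
        using assms(1) Suc by (simp add: iterate_Suc)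
    qed
  qed simp
  then show ?thesis by blast
qed

text \<open>Inside the closed set \<open>P\<close> the relation is deterministic, so two runs with
  the same start agree until they stop; this takes the place of confluence.\<close>

lemma rtranclp_normal_unique:
  assumes "r\<^sup>*\<^sup>* x y" "r\<^sup>*\<^sup>* x z" "P x"
    and closed: "\<And>x y. P x \<Longrightarrow> r x y \<Longrightarrow> P y"
    and det: "\<And>x y z. P x \<Longrightarrow> r x y \<Longrightarrow> r x z \<Longrightarrow> y = z"
    and normal: "\<And>w. \<not> r y w" "\<And>w. \<not> r z w"
  shows "y = z"
  using assms(1-3)
proof (induction rule: converse_rtranclp_induct)
  case base
  then show ?case
    using normal(1) by (metis converse_rtranclpE)
next
  case (step x x')
  from \<open>r\<^sup>*\<^sup>* x z\<close> show ?case
  proof (cases rule: converse_rtranclpE)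
    case base
    then show ?thesis
      using step normal(2) by blast
  next
    case (step x'')
    then show ?thesis
      using \<open>r x x'\<close> \<open>P x\<close> closed det \<open>r\<^sup>*\<^sup>* x' z \<Longrightarrow> P x' \<Longrightarrow> y = z\<close> by metis
  qed
qed

section \<open>Recolouring a column\<close>

lemma recolour_apply:
  "recolour i c U T x y =
     (if y = c \<and> (T x y = i \<or> T x y = Suc i) then (if x \<in> U then i else Suc i) else T x y)"
  by (auto simp: recolour_def)

lemma recolour_recolour: "recolour i c U (recolour i c U' T) = recolour i c U T"
  by (simp add: recolour_def fun_eq_iff)

lemma recolour_commute:
  "c \<noteq> c' \<Longrightarrow> recolour i c U (recolour i c' U' T) = recolour i c' U' (recolour i c U T)"
  by (intro ext) (auto simp: recolour_def)

lemma recolour_high_pure: "high_pure i T c \<Longrightarrow> recolour i c {} T = T"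
  by (intro ext) (auto simp: recolour_apply high_pure_def column_contains_def)

lemma recolour_low_pure: "low_pure i T c \<Longrightarrow> recolour i c UNIV T = T"
  by (intro ext) (auto simp: recolour_apply low_pure_def column_contains_def)

lemma recolour_other_column:
  assumes "c' \<noteq> c"
  shows "column_contains (recolour i c U T) c' k = column_contains T c' k"
    "sign i (recolour i c U T) c' = sign i T c'"
    "high_pure i (recolour i c U T) c' = high_pure i T c'"
    "low_pure i (recolour i c U T) c' = low_pure i T c'"
    "mixed i (recolour i c U T) c' = mixed i T c'"
    "lowest i (recolour i c U T) c' = lowest i T c'"
  using assms
  by (simp_all add: column_contains_def sign_def high_pure_def low_pure_def mixed_def lowest_def
      recolour_apply)

lemma column_contains_recolour_other:
  "k \<noteq> i \<Longrightarrow> k \<noteq> i + 1 \<Longrightarrow> column_contains (recolour i c U T) c' k = column_contains T c' k"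
proof -
  assume "k \<noteq> i" "k \<noteq> i + 1"
  then have "recolour i c U T x c' = k \<longleftrightarrow> T x c' = k" for x
    by (auto simp: recolour_def)
  then show ?thesis
    by (simp add: column_contains_def)
qed

lemma low_pure_recolour:
  "column_contains T c i \<or> column_contains T c (i + 1) \<Longrightarrow> low_pure i (recolour i c UNIV T) c"
  by (auto simp: low_pure_def column_contains_def recolour_apply)

lemma high_pure_recolour:
  "column_contains T c i \<or> column_contains T c (i + 1) \<Longrightarrow> high_pure i (recolour i c {} T) c"
  by (auto simp: high_pure_def column_contains_def recolour_apply)

section \<open>Benign tableaux on a convex diagram\<close>

text \<open>The assumption \<open>convex\<close> says that the diagram is an interval-closed subset
  of the product order, the property of skew shapes by which the missing boxes of a rectangle are
  supplied below.\<close>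

locale convex_diagram =
  fixes D :: "(nat \<times> nat) set" and m i :: nat
  assumes finite_D: "finite D"
    and convex: "(r, c) \<in> D \<Longrightarrow> (r', c') \<in> D \<Longrightarrow> r \<le> x \<Longrightarrow> x \<le> r' \<Longrightarrow> c \<le> y \<Longrightarrow> y \<le> c' \<Longrightarrow>
      (x, y) \<in> D"
    and i_pos: "1 \<le> i" and i_less: "i < m"
begin

text \<open>Being benign is split into this half, which recolouring by any initial segment of rows
  preserves, and \<open>staircase\<close>, which has to be checked anew for each resolution
  step.\<close>

definition sorted_off :: "filling \<Rightarrow> bool" where
  "sorted_off T \<longleftrightarrow> T \<in> fillings D m \<and> columns_weakly_increase D T \<and>
     (\<forall>r c c'. (r, c) \<in> D \<and> (r, c') \<in> D \<and> c \<le> c' \<and> \<not> (T r c \<in> {i, i + 1} \<and> T r c' \<in> {i, i + 1})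
        \<longrightarrow> T r c \<le> T r c')"

definition staircase :: "filling \<Rightarrow> bool" where
  "staircase T \<longleftrightarrow> (\<forall>A B. A < B \<and> mixed i T A \<and> mixed i T B \<longrightarrow> lowest i T B \<le> lowest i T A)"

lemma benign_iff: "benign D m i T \<longleftrightarrow> sorted_off T \<and> staircase T"
  by (auto simp: benign_def sorted_off_def staircase_def)

lemma in_D_if_pos: "T \<in> fillings D m \<Longrightarrow> 0 < T r c \<Longrightarrow> (r, c) \<in> D"
  by (auto simp: fillings_def intro: ccontr)

lemma in_D:
  assumes "sorted_off T" "T r c \<in> {i, i + 1}"
  shows "(r, c) \<in> D"
  using assms i_pos in_D_if_pos[of T r c] by (auto simp: sorted_off_def)

lemma column_mono:
  "sorted_off T \<Longrightarrow> (r, c) \<in> D \<Longrightarrow> (r', c) \<in> D \<Longrightarrow> r \<le> r' \<Longrightarrow> T r c \<le> T r' c"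
  unfolding sorted_off_def columns_weakly_increase_def by blast

lemma row_mono_off:
  "sorted_off T \<Longrightarrow> (r, c) \<in> D \<Longrightarrow> (r, c') \<in> D \<Longrightarrow> c \<le> c' \<Longrightarrow>
    T r c \<notin> {i, i + 1} \<or> T r c' \<notin> {i, i + 1} \<Longrightarrow> T r c \<le> T r c'"
  unfolding sorted_off_def by blast

lemma finite_column: "T \<in> fillings D m \<Longrightarrow> 0 < k \<Longrightarrow> finite {r. T r c = k}"
  by (rule finite_subset[of _ "fst ` D"]) (force intro: in_D_if_pos finite_D)+

lemma finite_columns:
  assumes "T \<in> fillings D m" "0 < k"
  shows "finite {c. column_contains T c k}"
proof (rule finite_subset)
  show "{c. column_contains T c k} \<subseteq> snd ` D"
  proof
    fix c assume "c \<in> {c. column_contains T c k}"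
    then obtain r where "T r c = k"
      by (auto simp: column_contains_def)
    then have "(r, c) \<in> D"
      using assms in_D_if_pos[of T r c] by simp
    then show "c \<in> snd ` D" by force
  qed
qed (simp add: finite_D)

lemma finite_pure_columns:
  assumes "T \<in> fillings D m"
  shows "finite (pure_columns i T)"
proof (rule finite_subset)
  show "pure_columns i T \<subseteq> {c. column_contains T c i} \<union> {c. column_contains T c (i + 1)}"
    by (auto simp: pure_columns_def sign_def)
  show "finite ({c. column_contains T c i} \<union> {c. column_contains T c (i + 1)})"
    using finite_columns[OF assms] i_pos by simp
qed

lemma lowest:
  assumes "sorted_off T" "column_contains T c i"
  shows "T (lowest i T c) c = i" "T r c = i \<Longrightarrow> r \<le> lowest i T c"
proof -
  have fin: "finite {r. T r c = i}"
    using finite_column assms i_pos by (simp add: sorted_off_def)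
  then have "lowest i T c \<in> {r. T r c = i}"
    unfolding lowest_def using assms(2) by (intro Max_in) (auto simp: column_contains_def)
  then show "T (lowest i T c) c = i" by simp
  show "T r c = i \<Longrightarrow> r \<le> lowest i T c"
    unfolding lowest_def using fin by (intro Max_ge) auto
qed

lemma lowest_split:
  assumes "sorted_off T" "column_contains T c i" "T r c \<in> {i, i + 1}"
  shows "T r c = (if r \<le> lowest i T c then i else i + 1)"
proof -
  have "(r, c) \<in> D" "(lowest i T c, c) \<in> D"
    using assms lowest(1)[OF assms(1,2)] by (auto intro: in_D)
  then have "r \<le> lowest i T c \<Longrightarrow> T r c \<le> i"
    using column_mono[OF assms(1)] lowest(1)[OF assms(1,2)] by metis
  then show ?thesis
    using lowest(2)[OF assms(1,2)] assms(3) by force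
qed

lemma lowest_less:
  assumes "sorted_off T" "column_contains T c i" "T r c = Suc i"
  shows "lowest i T c < r"
proof (rule ccontr)
  assume "\<not> ?thesis"
  then have "T r c = i"
    using lowest_split[OF assms(1,2), of r] assms(3) by simp
  with assms(3) show False by simp
qed

lemma recolour_lowest:
  assumes "sorted_off T" "column_contains T c i"
  shows "recolour i c {..lowest i T c} T = T"
proof (intro ext)
  show "recolour i c {..lowest i T c} T x y = T x y" for x y
    using lowest_split[OF assms, of x] by (auto simp: recolour_def)
qed

lemma lowest_eqI:
  assumes "T r c = i" "\<And>s. T s c = i \<Longrightarrow> s \<le> r"
  shows "lowest i T c = r"
  unfolding lowest_def
proof (rule Max_eqI)
  show "finite {r. T r c = i}"
    by (rule finite_subset[of _ "{..r}"]) (use assms(2) in blast, simp)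
qed (use assms in blast)+

text \<open>As \<open>U\<close> is an initial segment of rows, the recoloured column stays sorted.
  An entry outside \<open>{i, i + 1}\<close> lies below both values or above both, so its
  comparisons do not notice the change.\<close>

lemma sorted_off_recolour:
  assumes "sorted_off T" and U: "\<And>x y. x \<in> U \<Longrightarrow> y \<le> x \<Longrightarrow> y \<in> U"
  shows "sorted_off (recolour i c U T)"
proof -
  let ?V = "recolour i c U T"
  have same: "?V x y \<in> {i, i + 1} \<longleftrightarrow> T x y \<in> {i, i + 1}"
    and else: "T x y \<notin> {i, i + 1} \<Longrightarrow> ?V x y = T x y" for x y
    by (auto simp: recolour_apply)
  have fill: "?V \<in> fillings D m"
  proof -
    have "T \<in> fillings D m"
      using assms(1) by (simp add: sorted_off_def)
    then show ?thesis
      using i_pos i_less by (simp add: fillings_def recolour_apply)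
  qed
  have off: "?V x y \<le> ?V x' y'"
    if "T x y \<le> T x' y'" "T x y \<notin> {i, i + 1} \<or> T x' y' \<notin> {i, i + 1}" for x y x' y'
    using that by (auto simp: recolour_apply)
  have "columns_weakly_increase D ?V"
    unfolding columns_weakly_increase_def
  proof (intro allI impI, elim conjE)
    fix r r' y assume r: "(r, y) \<in> D" "(r', y) \<in> D" "r \<le> r'"
    then have le: "T r y \<le> T r' y"
      by (rule column_mono[OF assms(1)])
    show "?V r y \<le> ?V r' y"
    proof (cases "T r y \<in> {i, i + 1} \<and> T r' y \<in> {i, i + 1}")
      case True
      then show ?thesis
        using le U[of r' r] r(3) by (auto simp: recolour_apply)
    qed (use le in \<open>blast intro: off\<close>)
  qed
  moreover have "?V r y \<le> ?V r y'"
    if "(r, y) \<in> D" "(r, y') \<in> D" "y \<le> y'" "\<not> (?V r y \<in> {i, i + 1} \<and> ?V r y' \<in> {i, i + 1})"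
    for r y y'
    using that row_mono_off[OF assms(1) that(1-3)] same by (intro off) blast+
  ultimately show ?thesis
    using fill unfolding sorted_off_def by blast
qed

lemma staircase_recolour_pure:
  assumes "staircase T" "\<not> mixed i (recolour i c U T) c"
  shows "staircase (recolour i c U T)"
  unfolding staircase_def
proof (intro allI impI, elim conjE)
  fix A B
  assume "A < B" "mixed i (recolour i c U T) A" "mixed i (recolour i c U T) B"
  moreover from this have "A \<noteq> c" "B \<noteq> c"
    using assms(2) by auto
  ultimately show "lowest i (recolour i c U T) B \<le> lowest i (recolour i c U T) A"
    using assms(1) by (simp add: staircase_def recolour_other_column)
qed

text \<open>
  The invariant of the resolution processes started by both operators. As \<open>j\<close> is a pivot, column
  \<open>j - 1\<close> is not \<open>(i + 1)\<close>-pure and column \<open>j + 1\<close> is not \<open>i\<close>-pure; so resolution can only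
  exchange column \<open>j\<close> with a mixed neighbour, and at every moment at most one step is possible.
\<close>

definition hole :: "filling \<Rightarrow> nat \<Rightarrow> bool" where
  "hole V j \<longleftrightarrow> benign D m i V \<and> (low_pure i V j \<or> high_pure i V j) \<and> pivot i V j \<and>
     (\<forall>r A. descent i V r A \<longrightarrow> A = j \<or> Suc A = j)"

text \<open>The flip keeps the heights up to \<open>j\<close> and shifts all later ones by the same
  amount, so \<open>pivot\<close> survives; a new descent must involve the recoloured
  column.\<close>

lemma hole_recolour:
  assumes "hole V j" "U = UNIV \<or> U = {}"
  shows "hole (recolour i j U V) j"
proof -
  let ?W = "recolour i j U V"
  have pure: "low_pure i ?W j \<or> high_pure i ?W j"
    using assms low_pure_recolour[of V j i] high_pure_recolour[of V j i]
    by (auto simp: hole_def low_pure_def high_pure_def)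
  have h: "height i ?W x = height i V x + (if j < x then sign i ?W j - sign i V j else 0)" for x
    by (rule height_recolour) (simp add: recolour_other_column)
  have "sorted_off ?W"
    using assms by (intro sorted_off_recolour) (auto simp: hole_def benign_iff)
  moreover have "staircase ?W"
    using assms pure
    by (intro staircase_recolour_pure)
      (auto simp: hole_def benign_iff low_pure_def high_pure_def mixed_def)
  moreover have "pivot i ?W j"
    using assms h by (auto simp: hole_def pivot_def simp del: height_Suc)
  moreover have "A = j \<or> Suc A = j" if "descent i ?W r A" for r A
    using that assms(1) by (fastforce simp: hole_def descent_def recolour_apply)
  ultimately show ?thesis
    using pure by (auto simp: hole_def benign_iff)
qed

lemma hole_not_low_next:
  assumes "hole V j"
  shows "\<not> low_pure i V (Suc j)"
proof
  assume low: "low_pure i V (Suc j)"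
  have "height i V (Suc j) \<le> height i V (Suc (Suc j))"
    using assms unfolding hole_def pivot_def by (metis less_SucI lessI)
  with low show False by simp
qed

lemma hole_not_high_previous:
  assumes "hole V (Suc j)"
  shows "\<not> high_pure i V j"
proof
  assume high: "high_pure i V j"
  have "height i V (Suc j) \<le> height i V j"
    using assms by (simp add: hole_def pivot_def del: height_Suc)
  with high show False by simp
qed

section \<open>Reverse plane partitions among the benign tableaux\<close>

text \<open>By convexity a row is an interval, so only neighbouring boxes need comparison, and there
  the inequality can fail only at a descent.\<close>

lemma rpp_iff:
  assumes "sorted_off T"
  shows "T \<in> rpps D m \<longleftrightarrow> (\<forall>r c. \<not> descent i T r c)"
proof
  assume T: "T \<in> rpps D m"
  have False if "descent i T r c" for r c
  proof -
    have "T r c = i + 1" "T r (c + 1) = i"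
      using that by (auto simp: descent_def)
    moreover from this have "(r, c) \<in> D" "(r, c + 1) \<in> D"
      using in_D[OF assms] by auto
    ultimately show False
      using T unfolding rpps_def rows_weakly_increase_def
      by (metis (no_types, lifting) le_add1 mem_Collect_eq not_less_eq_eq Suc_eq_plus1 order_refl)
  qed
  then show "\<forall>r c. \<not> descent i T r c" by blast
next
  assume no: "\<forall>r c. \<not> descent i T r c"
  have "T r c \<le> T r c'" if "(r, c) \<in> D" "(r, c') \<in> D" "c \<le> c'" for r c c'
    using that(3,2)
  proof (induction c' rule: dec_induct)
    case (step y)
    have D: "(r, y) \<in> D"
      using convex[OF that(1) step.prems, of r y] step by simp
    have "T r y \<le> T r (Suc y)"
    proof (cases "T r y \<in> {i, i + 1} \<and> T r (Suc y) \<in> {i, i + 1}")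
      case True
      then show ?thesis
        using no[rule_format, of r y] by (auto simp: descent_def)
    next
      case False
      then show ?thesis
        using row_mono_off[OF assms D step.prems le_SucI[OF order_refl]] by blast
    qed
    with step.IH[OF D] show ?case
      by (rule order_trans)
  qed simp
  then show "T \<in> rpps D m"
    using assms unfolding rpps_def rows_weakly_increase_def sorted_off_def by blast
qed

text \<open>If the lowest \<open>i\<close> of \<open>B\<close> were lower than that of
  \<open>A\<close>, convexity would give a box of column \<open>A\<close> in its row. The row bounds
  its entry above by \<open>i\<close>, the column below by \<open>i\<close>, so \<open>A\<close>
  would have a lower \<open>i\<close>.\<close>

lemma benign_rpp:
  assumes "T \<in> rpps D m"
  shows "benign D m i T"
proof -
  have so: "sorted_off T"
    using assms unfolding sorted_off_def rpps_def rows_weakly_increase_def by blast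
  have "lowest i T B \<le> lowest i T A" if AB: "A < B" "mixed i T A" "mixed i T B" for A B
  proof (rule ccontr)
    let ?q = "lowest i T A" and ?r = "lowest i T B"
    assume less: "\<not> ?thesis"
    have col: "column_contains T A i" "column_contains T B i"
      using AB by (auto simp: mixed_def)
    have eq: "T ?q A = i" "T ?r B = i"
      using lowest(1)[OF so] col by auto
    then have D: "(?q, A) \<in> D" "(?r, B) \<in> D"
      using in_D[OF so] by auto
    then have "(?r, A) \<in> D"
      using convex[OF D, of ?r A] less AB(1) by simp
    moreover from this have "T ?r A \<le> i"
      using assms D AB(1) eq unfolding rpps_def rows_weakly_increase_def
      by (metis (no_types, lifting) less_imp_le mem_Collect_eq)
    ultimately have "T ?r A = i"
      using column_mono[OF so D(1), of ?r] eq less by simp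
    then show False
      using lowest(2)[OF so col(1)] less by simp
  qed
  then show ?thesis
    using so by (simp add: benign_iff staircase_def)
qed

section \<open>Resolution moves the hole\<close>

text \<open>The outcome of the rule \<open>mixed_low\<close>, seen as the \<open>i\<close>-pure
  column passing from \<open>A + 1\<close> to \<open>A\<close>.\<close>

definition move_left :: "filling \<Rightarrow> nat \<Rightarrow> filling" where
  "move_left V A = recolour i A UNIV (recolour i (A + 1) {..lowest i V A} V)"

text \<open>The outcome of the rule \<open>high_mixed\<close>, seen as the
  \<open>(i + 1)\<close>-pure column passing from \<open>A\<close> to \<open>A + 1\<close>.\<close>

definition move_right :: "filling \<Rightarrow> nat \<Rightarrow> filling" where
  "move_right V A = recolour i A {..lowest i V (A + 1)} (recolour i (A + 1) {} V)"

lemma move_left_apply: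
  "move_left V A x y =
    (if V x y \<in> {i, Suc i} \<and> y = A then i
     else if V x y \<in> {i, Suc i} \<and> y = Suc A then (if x \<le> lowest i V A then i else Suc i)
     else V x y)"
  by (auto simp: move_left_def recolour_def)

lemma move_right_apply:
  "move_right V A x y =
    (if V x y \<in> {i, Suc i} \<and> y = A then (if x \<le> lowest i V (Suc A) then i else Suc i)
     else if V x y \<in> {i, Suc i} \<and> y = Suc A then Suc i
     else V x y)"
  by (auto simp: move_right_def recolour_def)

lemma move_other_column:
  assumes "c \<noteq> A" "c \<noteq> Suc A"
  shows "column_contains (move_left V A) c k = column_contains V c k"
    "column_contains (move_right V A) c k = column_contains V c k"
    "sign i (move_left V A) c = sign i V c" "sign i (move_right V A) c = sign i V c"
    "mixed i (move_left V A) c = mixed i V c" "mixed i (move_right V A) c = mixed i V c"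
    "lowest i (move_left V A) c = lowest i V c" "lowest i (move_right V A) c = lowest i V c"
  using assms by (simp_all add: move_left_def move_right_def recolour_other_column)

lemma sorted_off_move:
  assumes "sorted_off V"
  shows "sorted_off (move_left V A)" "sorted_off (move_right V A)"
  unfolding move_left_def move_right_def using assms by (auto intro!: sorted_off_recolour)

lemma staircaseD:
  "staircase T \<Longrightarrow> mixed i T A \<Longrightarrow> mixed i T B \<Longrightarrow> A < B \<Longrightarrow> lowest i T B \<le> lowest i T A"
  by (simp add: staircase_def)

text \<open>One step of the run started by \<open>e_op\<close>. The fourth claim is the reversal:
  with the hole flipped on both sides, a \<open>high_mixed\<close> step leads back. The height at
  the hole and the weight are carried along unchanged.\<close>

lemma left_step:
  assumes hole: "hole V (Suc A)" and low: "low_pure i V (Suc A)" and mixed: "mixed i V A"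
    and desc: "descent i V x A"
  shows "hole (move_left V A) A" "low_pure i (move_left V A) A"
    and "resolution_step D m i V (move_left V A)"
    and "resolution_step D m i (recolour i A {} (move_left V A)) (recolour i (Suc A) {} V)"
    and "height i (move_left V A) A = height i V (Suc A)"
    and "1 \<le> k \<Longrightarrow> wt (move_left V A) k = wt V k"
proof -
  define r where "r = lowest i V A"
  define V' where "V' = move_left V A"
  have benign: "benign D m i V" and so: "sorted_off V" and st: "staircase V"
    using hole by (auto simp: hole_def benign_iff)
  have cont: "column_contains V A i" "column_contains V A (Suc i)" "column_contains V (Suc A) i"
    "\<not> column_contains V (Suc A) (Suc i)"
    using mixed low by (auto simp: mixed_def low_pure_def)
  have x: "V x A = Suc i" "V x (Suc A) = i"
    using desc by (auto simp: descent_def)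
  have r: "V r A = i"
    unfolding r_def using lowest(1)[OF so cont(1)] .
  have "r < x"
    unfolding r_def using lowest_less[OF so cont(1)] x by blast
  have D: "(r, A) \<in> D" "(x, Suc A) \<in> D"
    using in_D[OF so] r x by auto
  \<comment> \<open>The rectangle from \<open>(r, A)\<close> to the right box of the descent
    contains \<open>(r, Suc A)\<close>. Its entry is at most \<open>i\<close> by the column and, if
    outside \<open>{i, i + 1}\<close>, at least \<open>i\<close> by the row; so it is
    \<open>i\<close>.\<close>
  have D': "(r, Suc A) \<in> D"
    using convex[OF D, of r "Suc A"] \<open>r < x\<close> by simp
  have "V r (Suc A) \<le> i"
    using column_mono[OF so D' D(2)] \<open>r < x\<close> x by simp
  moreover have "V r A \<le> V r (Suc A)" if "V r (Suc A) \<notin> {i, i + 1}"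
    using that D D' by (intro row_mono_off[OF so]) auto
  ultimately have r': "V r (Suc A) = i"
    using r by fastforce
  \<comment> \<open>Rows \<open>r\<close> and \<open>x\<close> witness that the new column
    \<open>Suc A\<close> really contains both values.\<close>
  have V': "V' r (Suc A) = i" "V' x (Suc A) = Suc i"
    using r' x \<open>r < x\<close> by (simp_all add: V'_def move_left_apply r_def)
  have low': "low_pure i V' A"
    unfolding V'_def move_left_def
    by (rule low_pure_recolour) (simp add: recolour_other_column cont)
  have mixed': "mixed i V' (Suc A)"
    using V' by (auto simp: mixed_def column_contains_def)
  have lowest': "lowest i V' (Suc A) = r"
    using V'(1) by (rule lowest_eqI) (auto simp: V'_def move_left_apply r_def split: if_splits)
  have so': "sorted_off V'"
    unfolding V'_def by (rule sorted_off_move[OF so])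
  have other: "sign i V' c = sign i V c" "mixed i V' c = mixed i V c" "lowest i V' c = lowest i V c"
    "column_contains V' c k = column_contains V c k"
    if "c \<noteq> A" "c \<noteq> Suc A" for c k
    unfolding V'_def using that by (auto simp: move_other_column)
  have not_mixed: "\<not> mixed i V' A"
    using low' by (simp add: low_pure_def mixed_def)
  have st': "staircase V'"
    unfolding staircase_def
  proof (intro allI impI, elim conjE)
    fix P Q assume PQ: "P < Q" "mixed i V' P" "mixed i V' Q"
    then have "P \<noteq> A" "Q \<noteq> A"
      using not_mixed by auto
    then consider "P = Suc A" "Suc A < Q" | "Q = Suc A" "P < A"
      | "P \<noteq> A" "P \<noteq> Suc A" "Q \<noteq> A" "Q \<noteq> Suc A"
      using PQ(1) by linarith
    then show "lowest i V' Q \<le> lowest i V' P"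
    proof cases
      case 1
      then show ?thesis
        using PQ other[of Q] staircaseD[OF st mixed, of Q] by (simp add: lowest' r_def)
    next
      case 2
      then show ?thesis
        using PQ other[of P] staircaseD[OF st _ mixed, of P] by (simp add: lowest' r_def)
    next
      case 3
      then show ?thesis
        using PQ other[of P] other[of Q] staircaseD[OF st, of P Q] by simp
    qed
  qed
  have signs: "sign i V' A = sign i V (Suc A)" "sign i V' (Suc A) = sign i V A"
    using low low' mixed mixed' by simp_all
  have height: "height i V' y = height i V y - (if y = Suc A then 1 else 0)" for y
    using height_swap[OF other(1) signs, of y] low' mixed by simp
  have pivot': "pivot i V' A"
  proof -
    \<comment> \<open>Column \<open>A\<close> is mixed, so the heights at \<open>A\<close> and
      \<open>Suc A\<close> agree and the minimum at the old pivot is also the one at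
      \<open>A\<close>.\<close>
    have before: "height i V A \<le> height i V y" if "y \<le> Suc A" for y
      using hole that mixed by (simp add: hole_def pivot_def)
    have after: "height i V A - 1 \<le> height i V y" if "Suc A < y" for y
      using hole that mixed low by (simp add: hole_def pivot_def)
    have "height i V' A \<le> height i V' y" if "y \<le> A" for y
      using before[of y] that by (simp add: height)
    moreover have "height i V' (Suc A) \<le> height i V' y" if "A < y" for y
      using after[of y] that mixed height[of "Suc A"] height[of y]
      by (cases "y = Suc A") (auto simp del: height_Suc simp: height_Suc[of i V])
    ultimately show ?thesis
      by (simp add: pivot_def del: height_Suc)
  qed
  have desc': "B = A \<or> Suc B = A" if B: "descent i V' s B" for s B
  proof (rule ccontr)
    assume neg: "\<not> ?thesis"
    show False
    proof (cases "B = Suc A")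
      case True
      have s: "V' s (Suc A) = Suc i" "V s (Suc (Suc A)) = i"
        using B True by (auto simp: descent_def V'_def move_left_apply split: if_splits)
      then have cont: "column_contains V (Suc (Suc A)) i"
        by (auto simp: column_contains_def)
      \<comment> \<open>This column contains \<open>i\<close> and is not \<open>i\<close>-pure
        because the hole is a pivot. The staircase condition then confines its entries
        \<open>i\<close> to rows up to \<open>r\<close>, whereas the \<open>i + 1\<close> of the new
        mixed column lie below \<open>r\<close>.\<close>
      then have "mixed i V (Suc (Suc A))"
        using hole_not_low_next[OF hole] by (auto simp: low_pure_def mixed_def)
      then have "lowest i V (Suc (Suc A)) \<le> r"
        unfolding r_def by (intro staircaseD[OF st mixed]) auto
      then have "s \<le> r"
        using lowest(2)[OF so cont, of s] s by simp
      then show False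
        using s(1) by (auto simp: V'_def move_left_apply r_def split: if_splits)
    next
      case False
      then have "descent i V s B"
        using neg B by (auto simp: descent_def V'_def move_left_apply split: if_splits)
      then show False
        using hole neg False by (auto simp: hole_def)
    qed
  qed
  show hole': "hole (move_left V A) A"
    using so' st' low' pivot' desc' by (simp add: hole_def benign_iff V'_def)
  show "low_pure i (move_left V A) A"
    using low' by (simp add: V'_def)
  show "resolution_step D m i V (move_left V A)"
    unfolding move_left_def using resolution_step.mixed_low[OF benign desc mixed] low by simp
  show "height i (move_left V A) A = height i V (Suc A)"
    using height[of A] mixed by (simp add: V'_def)
  show "wt (move_left V A) k = wt V k" if "1 \<le> k"
  proof (cases "k = Suc i")
    case True
    \<comment> \<open>The value \<open>i + 1\<close> has only moved from column \<open>A\<close> to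
      column \<open>Suc A\<close>; both columns contain \<open>i\<close> before and after.\<close>
    have "{c. column_contains V' c k} = insert (Suc A) ({c. column_contains V c k} - {A})"
    proof (rule set_eqI)
      fix c
      show "c \<in> {c. column_contains V' c k} \<longleftrightarrow>
          c \<in> insert (Suc A) ({c. column_contains V c k} - {A})"
        using other(4)[of c k] low' mixed' True
        by (cases "c = A"; cases "c = Suc A") (simp_all add: low_pure_def mixed_def)
    qed
    moreover have "card (insert (Suc A) (X - {A})) = card X" if "A \<in> X" "Suc A \<notin> X" "finite X" for X
      using that by (metis Diff_iff card.insert card_Suc_Diff1 finite_Diff)
    ultimately show ?thesis
      using cont True finite_columns[of V k] so by (simp add: wt_def V'_def sorted_off_def)
  next
    case False
    have "column_contains V' c k = column_contains V c k" for c
      using other(4)[of c k] low' mixed' cont False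
      by (cases "k = i"; cases "c = A"; cases "c = Suc A")
        (auto simp: low_pure_def mixed_def V'_def move_left_def column_contains_recolour_other)
    then show ?thesis
      by (simp add: wt_def V'_def)
  qed
  \<comment> \<open>Flipping the hole creates a descent in row \<open>r\<close>. Resolving it keeps
    \<open>r\<close> as the row of the lowest \<open>i\<close>, so column \<open>A\<close> gets back
    exactly its colours in \<open>V\<close>.\<close>
  let ?W = "recolour i A {} V'"
  have "hole ?W A"
    using hole' by (intro hole_recolour) (simp_all add: V'_def)
  moreover have "high_pure i ?W A"
    using low' by (intro high_pure_recolour) (simp add: low_pure_def)
  moreover have "descent i ?W r A"
    using V'(1) r by (simp add: descent_def recolour_apply V'_def move_left_apply)
  moreover have "mixed i ?W (A + 1)" "lowest i ?W (A + 1) = r"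
    using mixed' lowest' by (simp_all add: recolour_other_column)
  moreover have "recolour i A {..r} (recolour i (A + 1) {} ?W) = recolour i (Suc A) {} V"
    using recolour_lowest[OF so cont(1)]
    by (simp add: V'_def move_left_def r_def recolour_recolour recolour_commute[of A "Suc A"])
  ultimately show "resolution_step D m i (recolour i A {} (move_left V A)) (recolour i (Suc A) {} V)"
    using resolution_step.high_mixed[of D m i ?W r A] by (simp add: hole_def V'_def)
qed

text \<open>The mirror image of \<open>left_step\<close> for the run started by \<open>f_op\<close>.
  Heights and weights along the run are not recorded: what is needed of \<open>f_op\<close> there
  follows from \<open>e_op\<close> by inversion.\<close>

lemma right_step:
  assumes hole: "hole W A" and high: "high_pure i W A" and mixed: "mixed i W (Suc A)"
    and desc: "descent i W x A"
  shows "hole (move_right W A) (Suc A)" "high_pure i (move_right W A) (Suc A)"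
    and "resolution_step D m i W (move_right W A)"
    and "resolution_step D m i (recolour i (Suc A) UNIV (move_right W A)) (recolour i A UNIV W)"
proof -
  define r where "r = lowest i W (Suc A)"
  define W' where "W' = move_right W A"
  have benign: "benign D m i W" and so: "sorted_off W" and st: "staircase W"
    using hole by (auto simp: hole_def benign_iff)
  have cont: "column_contains W (Suc A) i" "column_contains W (Suc A) (Suc i)"
    using mixed by (auto simp: mixed_def)
  have x: "W x A = Suc i" "W x (Suc A) = i"
    using desc by (auto simp: descent_def)
  obtain y where y: "W y (Suc A) = Suc i"
    using cont by (auto simp: column_contains_def)
  have r: "W r (Suc A) = i"
    unfolding r_def using lowest(1)[OF so cont(1)] .
  have "x \<le> r"
    unfolding r_def using lowest(2)[OF so cont(1)] x by blast
  have "r < y"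
    unfolding r_def using lowest_less[OF so cont(1)] y by blast
  have D: "(x, A) \<in> D" "(r, Suc A) \<in> D" "(y, Suc A) \<in> D"
    using in_D[OF so] r x y by auto
  \<comment> \<open>Two rectangles are used: the left box of the descent and
    \<open>(r, Suc A)\<close> give \<open>(r, A)\<close>, and this with the \<open>i + 1\<close> in
    row \<open>y\<close> gives \<open>(y, A)\<close>. Both boxes of column \<open>A\<close> must
    hold \<open>i + 1\<close>.\<close>
  have rD: "(r, A) \<in> D"
    using convex[OF D(1,2), of r A] \<open>x \<le> r\<close> by simp
  have yD: "(y, A) \<in> D"
    using convex[OF rD D(3), of y A] \<open>r < y\<close> by simp
  have "Suc i \<le> W r A"
    using column_mono[OF so D(1) rD] \<open>x \<le> r\<close> x by simp
  moreover have "W r A \<le> W r (Suc A)" if "W r A \<notin> {i, i + 1}"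
    using that D rD by (intro row_mono_off[OF so]) auto
  ultimately have r': "W r A = Suc i"
    using r by fastforce
  have "Suc i \<le> W y A"
    using column_mono[OF so rD yD] \<open>r < y\<close> r' by simp
  moreover have "W y A \<le> W y (Suc A)" if "W y A \<notin> {i, i + 1}"
    using that D yD by (intro row_mono_off[OF so]) auto
  ultimately have y': "W y A = Suc i"
    using y by fastforce
  have W': "W' r A = i" "W' y A = Suc i"
    using r' y' \<open>r < y\<close> by (simp_all add: W'_def move_right_apply r_def)
  have high': "high_pure i W' (Suc A)"
    unfolding W'_def move_right_def
    using high_pure_recolour[of W "Suc A" i] cont by (simp add: recolour_other_column)
  have mixed': "mixed i W' A"
    using W' by (auto simp: mixed_def column_contains_def)
  have lowest': "lowest i W' A = r"
    using W'(1) by (rule lowest_eqI) (auto simp: W'_def move_right_apply r_def split: if_splits)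
  have so': "sorted_off W'"
    unfolding W'_def by (rule sorted_off_move[OF so])
  have other: "sign i W' c = sign i W c" "mixed i W' c = mixed i W c" "lowest i W' c = lowest i W c"
    if "c \<noteq> A" "c \<noteq> Suc A" for c
    unfolding W'_def using that by (auto simp: move_other_column)
  have not_mixed: "\<not> mixed i W' (Suc A)"
    using high' by (simp add: high_pure_def mixed_def)
  have st': "staircase W'"
    unfolding staircase_def
  proof (intro allI impI, elim conjE)
    fix P Q assume PQ: "P < Q" "mixed i W' P" "mixed i W' Q"
    then have "P \<noteq> Suc A" "Q \<noteq> Suc A"
      using not_mixed by auto
    then consider "P = A" "Suc A < Q" | "Q = A" "P < A"
      | "P \<noteq> A" "P \<noteq> Suc A" "Q \<noteq> A" "Q \<noteq> Suc A"
      using PQ(1) by linarith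
    then show "lowest i W' Q \<le> lowest i W' P"
    proof cases
      case 1
      then show ?thesis
        using PQ other[of Q] staircaseD[OF st mixed, of Q] by (simp add: lowest' r_def)
    next
      case 2
      then show ?thesis
        using PQ other[of P] staircaseD[OF st _ mixed, of P] by (simp add: lowest' r_def)
    next
      case 3
      then show ?thesis
        using PQ other[of P] other[of Q] staircaseD[OF st, of P Q] by simp
    qed
  qed
  have signs: "sign i W' A = sign i W (Suc A)" "sign i W' (Suc A) = sign i W A"
    using high high' mixed mixed' by simp_all
  have height: "height i W' y = height i W y - (if y = Suc A then 1 else 0)" for y
    using height_swap[OF other(1) signs, of y] high mixed' by simp
  have pivot': "pivot i W' (Suc A)"
  proof -
    have before: "height i W A \<le> height i W y" if "y \<le> A" for y
      using hole that by (simp add: hole_def pivot_def)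
    have after: "height i W A + 1 \<le> height i W y" if "A < y" for y
      using hole that high by (simp add: hole_def pivot_def)
    have "height i W' (Suc A) \<le> height i W' y" if "y \<le> Suc A" for y
      using before[of y] that high height[of "Suc A"] height[of y]
      by (cases "y = Suc A") (auto simp del: height_Suc simp: height_Suc[of i W])
    moreover have "height i W' (Suc (Suc A)) \<le> height i W' y" if "Suc A < y" for y
      using after[of y] that high mixed height[of "Suc (Suc A)"] height[of y]
      by (simp del: height_Suc add: height_Suc[of i W])
    ultimately show ?thesis
      by (simp add: pivot_def del: height_Suc)
  qed
  have desc': "B = Suc A \<or> Suc B = Suc A" if B: "descent i W' s B" for s B
  proof (rule ccontr)
    assume neg: "\<not> ?thesis"
    show False
    proof (cases "Suc B = A")
      case True
      have s: "W s B = Suc i" "W' s A = i"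
        using B True by (auto simp: descent_def W'_def move_right_apply split: if_splits)
      then have "column_contains W B (Suc i)"
        by (auto simp: column_contains_def)
      \<comment> \<open>Column \<open>B\<close> is not \<open>(i + 1)\<close>-pure because the hole
        is a pivot. By the staircase condition its lowest \<open>i\<close> is in row
        \<open>r\<close> or lower, so its \<open>i + 1\<close> lie below \<open>r\<close>, while the
        \<open>i\<close> of the new mixed column end at \<open>r\<close>.\<close>
      then have mixedB: "mixed i W B"
        using hole_not_high_previous[of W B] hole True by (auto simp: high_pure_def mixed_def)
      then have "r \<le> lowest i W B"
        unfolding r_def using True by (intro staircaseD[OF st _ mixed]) auto
      moreover have "s \<le> r"
        using s(2) by (auto simp: W'_def move_right_apply r_def split: if_splits)
      ultimately show False
        using lowest_less[OF so _ s(1)] mixedB by (fastforce simp: mixed_def)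
    next
      case False
      then have "descent i W s B"
        using neg B by (auto simp: descent_def W'_def move_right_apply split: if_splits)
      then show False
        using hole neg False by (auto simp: hole_def)
    qed
  qed
  show hole': "hole (move_right W A) (Suc A)"
    using so' st' high' pivot' desc' by (simp add: hole_def benign_iff W'_def)
  show "high_pure i (move_right W A) (Suc A)"
    using high' by (simp add: W'_def)
  show "resolution_step D m i W (move_right W A)"
    unfolding move_right_def using resolution_step.high_mixed[OF benign desc high] mixed by simp
  let ?V = "recolour i (Suc A) UNIV W'"
  have "hole ?V (Suc A)"
    using hole' by (intro hole_recolour) (simp_all add: W'_def)
  moreover have "low_pure i ?V (A + 1)"
    using high' low_pure_recolour[of W' "Suc A" i] by (simp add: high_pure_def)
  moreover have "descent i ?V y A"
    using W'(2) y by (simp add: descent_def recolour_apply W'_def move_right_apply)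
  moreover have "mixed i ?V A" "lowest i ?V A = r"
    using mixed' lowest' by (simp_all add: recolour_other_column)
  moreover have "recolour i A UNIV (recolour i (A + 1) {..r} ?V) = recolour i A UNIV W"
    using recolour_lowest[OF so cont(1)]
    by (simp add: W'_def move_right_def r_def recolour_recolour recolour_commute[of "Suc A" A])
  ultimately show "resolution_step D m i (recolour i (Suc A) UNIV (move_right W A)) (recolour i A UNIV W)"
    using resolution_step.mixed_low[of D m i ?V y A] by (simp add: hole_def W'_def)
qed

section \<open>Determinism of resolution\<close>

text \<open>A descent must involve \<open>j\<close>, and as \<open>j\<close> contains no
  \<open>i + 1\<close> it can only be the right column. This excludes \<open>high_mixed\<close>, the
  pivot excludes \<open>high_low\<close>, and \<open>mixed_low\<close> has a single outcome.\<close>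

lemma low_hole_step:
  assumes "hole V j" "low_pure i V j" "resolution_step D m i V V'"
  obtains A where "j = Suc A" "mixed i V A" "V' = move_left V A" "hole V' A" "low_pure i V' A"
  using assms(3)
proof cases
  case (mixed_low r A)
  have "A \<noteq> j"
    using mixed_low assms(2) by (auto simp: mixed_def low_pure_def)
  then have "j = Suc A"
    using mixed_low assms(1) by (auto simp: hole_def)
  then show thesis
    using mixed_low left_step[of V A r] assms that[of A] by (simp add: move_left_def)
next
  case (high_mixed r A)
  have "A \<noteq> j" "Suc A \<noteq> j"
    using high_mixed assms(2) by (auto simp: mixed_def low_pure_def high_pure_def)
  then show thesis
    using high_mixed assms(1) by (auto simp: hole_def)
next
  case (high_low r A)
  have "A \<noteq> j"
    using high_low assms(2) by (auto simp: high_pure_def low_pure_def)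
  then have "j = Suc A"
    using high_low assms(1) by (auto simp: hole_def)
  then show thesis
    using hole_not_high_previous assms(1) high_low by blast
qed

lemma high_hole_step:
  assumes "hole V j" "high_pure i V j" "resolution_step D m i V V'"
  shows "V' = move_right V j" "hole V' (Suc j)" "high_pure i V' (Suc j)"
proof -
  have "V' = move_right V j \<and> hole V' (Suc j) \<and> high_pure i V' (Suc j)"
    using assms(3)
  proof cases
    case (mixed_low r A)
    have "A \<noteq> j" "Suc A \<noteq> j"
      using mixed_low assms(2) by (auto simp: mixed_def low_pure_def high_pure_def)
    then show ?thesis
      using mixed_low assms(1) by (auto simp: hole_def)
  next
    case (high_mixed r A)
    have "Suc A \<noteq> j"
      using high_mixed assms(2) by (auto simp: mixed_def high_pure_def)
    then have "A = j"
      using high_mixed assms(1) by (auto simp: hole_def)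
    then show ?thesis
      using high_mixed right_step[of V j r] assms by (simp add: move_right_def)
  next
    case (high_low r A)
    have "Suc A \<noteq> j"
      using high_low assms(2) by (auto simp: high_pure_def low_pure_def)
    then have "A = j"
      using high_low assms(1) by (auto simp: hole_def)
    then show ?thesis
      using hole_not_low_next assms(1) high_low by auto
  qed
  then show "V' = move_right V j" "hole V' (Suc j)" "high_pure i V' (Suc j)"
    by auto
qed

text \<open>Tableaux with a hole of a fixed purity are closed under resolution, which is
  deterministic on them. So \<open>T\<close> is the only descent-free result and the definite
  description picks it.\<close>

lemma descent_resolution_eq:
  assumes hole: "hole V j" and T: "(resolution_step D m i)\<^sup>*\<^sup>* V T" "T \<in> rpps D m"
  shows "descent_resolution D m i V = T"
  unfolding descent_resolution_def
proof (rule the_equality)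
  have no: "\<not> (\<exists>r c. descent i T r c)"
    using rpp_iff[of T] benign_rpp[OF T(2)] T(2) by (simp add: benign_iff)
  then show "(resolution_step D m i)\<^sup>*\<^sup>* V T \<and> \<not> (\<exists>r c. descent i T r c)"
    using T(1) by simp
  fix T' assume T': "(resolution_step D m i)\<^sup>*\<^sup>* V T' \<and> \<not> (\<exists>r c. descent i T' r c)"
  have normal: "\<not> resolution_step D m i T w" "\<not> resolution_step D m i T' w" for w
    using no T' by (auto elim: resolution_step.cases)
  define low where "low V \<longleftrightarrow> (\<exists>j. hole V j \<and> low_pure i V j)" for V
  define high where "high V \<longleftrightarrow> (\<exists>j. hole V j \<and> high_pure i V j)" for V
  have "low V \<or> high V"
    using hole by (auto simp: hole_def low_def high_def)
  then show "T' = T"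
  proof
    assume "low V"
    with T'[THEN conjunct1] T(1) show ?thesis
    proof (rule rtranclp_normal_unique[where P = low])
      show "low y" if "low x" "resolution_step D m i x y" for x y
        using that low_hole_step unfolding low_def by metis
      show "y = z" if "low x" "resolution_step D m i x y" "resolution_step D m i x z" for x y z
        using that low_hole_step unfolding low_def by (metis nat.inject)
    qed (use normal in auto)
  next
    assume "high V"
    with T'[THEN conjunct1] T(1) show ?thesis
    proof (rule rtranclp_normal_unique[where P = high])
      show "high y" if "high x" "resolution_step D m i x y" for x y
        using that high_hole_step unfolding high_def by metis
      show "y = z" if "high x" "resolution_step D m i x y" "resolution_step D m i x z" for x y z
        using that high_hole_step(1) unfolding high_def by metis
    qed (use normal in auto)
  qed
qed

section \<open>Complete runs and their reversal\<close>

text \<open>The run ends because the hole moves to the left. The reversed steps, joined in opposite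
  order, lead from \<open>T\<close> with its hole flipped to \<open>V\<close> with its hole
  flipped.\<close>

lemma resolve_low:
  assumes "hole V j" "low_pure i V j"
  shows "\<exists>p T. T \<in> rpps D m \<and> (resolution_step D m i)\<^sup>*\<^sup>* V T \<and> hole T p \<and> low_pure i T p \<and>
    (resolution_step D m i)\<^sup>*\<^sup>* (recolour i p {} T) (recolour i j {} V) \<and>
    height i T p = height i V j \<and> (\<forall>k\<ge>1. wt T k = wt V k)"
  using assms
proof (induction j arbitrary: V rule: less_induct)
  case (less j V)
  have so: "sorted_off V"
    using less.prems by (simp add: hole_def benign_iff)
  show ?case
  proof (cases "V \<in> rpps D m")
    case True
    then show ?thesis
      using less.prems by blast
  next
    case False
    then obtain r A where desc: "descent i V r A"
      using rpp_iff[OF so] by blast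
    then have cont: "column_contains V A (i + 1)"
      by (auto simp: descent_def column_contains_def)
    then have "A \<noteq> j"
      using less.prems(2) by (auto simp: low_pure_def)
    then have j: "j = Suc A"
      using less.prems(1) desc by (auto simp: hole_def)
    then have mixed: "mixed i V A"
      using hole_not_high_previous less.prems(1) cont by (auto simp: mixed_def high_pure_def)
    note step = left_step[OF less.prems[unfolded j] mixed desc]
    obtain p T where T: "T \<in> rpps D m" "(resolution_step D m i)\<^sup>*\<^sup>* (move_left V A) T"
      "hole T p" "low_pure i T p"
      "(resolution_step D m i)\<^sup>*\<^sup>* (recolour i p {} T) (recolour i A {} (move_left V A))"
      "height i T p = height i (move_left V A) A" "\<forall>k\<ge>1. wt T k = wt (move_left V A) k"
      using less.IH[OF _ step(1,2)] j by blast
    have "(resolution_step D m i)\<^sup>*\<^sup>* V T"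
      using step(3) T(2) by (rule converse_rtranclp_into_rtranclp[where r = "resolution_step D m i"])
    moreover have "(resolution_step D m i)\<^sup>*\<^sup>* (recolour i p {} T) (recolour i j {} V)"
      using rtranclp.rtrancl_into_rtrancl[where r = "resolution_step D m i", OF T(5) step(4)] unfolding j .
    moreover have "height i T p = height i V j"
      unfolding T(6) step(5) j ..
    moreover have "\<forall>k\<ge>1. wt T k = wt V k"
      using T(7) step(6) by metis
    ultimately show ?thesis
      using T(1,3,4) by (intro exI[of _ p] exI[of _ T] conjI)
  qed
qed

text \<open>Now the hole moves to the right, and the number \<open>N\<close> bounding the columns of
  the diagram ensures that the run ends.\<close>

lemma resolve_high:
  assumes "hole V j" "high_pure i V j"
  shows "\<exists>p T. T \<in> rpps D m \<and> (resolution_step D m i)\<^sup>*\<^sup>* V T \<and> hole T p \<and> high_pure i T p \<and>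
    (resolution_step D m i)\<^sup>*\<^sup>* (recolour i p UNIV T) (recolour i j UNIV V)"
proof -
  obtain N where N: "\<And>c. c \<in> snd ` D \<Longrightarrow> c < N"
    using finite_D by (metis finite_imageI finite_nat_set_iff_bounded)
  show ?thesis
    using assms
  proof (induction "N - j" arbitrary: j V rule: less_induct)
    case (less j V)
    have so: "sorted_off V"
      using less.prems by (simp add: hole_def benign_iff)
    show ?case
    proof (cases "V \<in> rpps D m")
      case True
      then show ?thesis
        using less.prems by blast
    next
      case False
      then obtain r A where desc: "descent i V r A"
        using rpp_iff[OF so] by blast
      then have cont: "column_contains V (Suc A) i"
        by (auto simp: descent_def column_contains_def)
      then have "Suc A \<noteq> j"
        using less.prems(2) by (auto simp: high_pure_def)
      then have A: "A = j"
        using less.prems(1) desc by (auto simp: hole_def)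
      have mixed: "mixed i V (Suc j)"
        using hole_not_low_next less.prems(1) cont by (auto simp: A mixed_def low_pure_def)
      note step = right_step[OF less.prems mixed desc[unfolded A]]
      have "(r, j) \<in> D"
        using in_D[OF so, of r j] desc by (simp add: A descent_def)
      then have "j < N"
        using N by force
      then obtain p T where T: "T \<in> rpps D m" "(resolution_step D m i)\<^sup>*\<^sup>* (move_right V j) T"
        "hole T p" "high_pure i T p"
        "(resolution_step D m i)\<^sup>*\<^sup>* (recolour i p UNIV T)
           (recolour i (Suc j) UNIV (move_right V j))"
        using less.hyps[OF _ step(1,2)] by (metis diff_less_mono2 lessI)
      have "(resolution_step D m i)\<^sup>*\<^sup>* V T"
        using step(3) T(2) by (rule converse_rtranclp_into_rtranclp[where r = "resolution_step D m i"])
      moreover have "(resolution_step D m i)\<^sup>*\<^sup>* (recolour i p UNIV T) (recolour i j UNIV V)"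
        using T(5) step(4) by (rule rtranclp.rtrancl_into_rtrancl[where r = "resolution_step D m i"])
      ultimately show ?thesis
        using T(1,3,4) by (intro exI[of _ p] exI[of _ T] conjI)
    qed
  qed
qed

section \<open>The crystal operators\<close>

lemma hole_rpp:
  assumes "T \<in> rpps D m" "pivot i T j" "low_pure i T j \<or> high_pure i T j"
  shows "hole T j"
  using benign_rpp[OF assms(1)] rpp_iff[of T] assms by (simp add: hole_def benign_iff)

lemma rpp_finite_pure_columns: "T \<in> rpps D m \<Longrightarrow> finite (pure_columns i T)"
  by (rule finite_pure_columns) (simp add: rpps_def)

lemma e_op_eq:
  assumes "T \<in> rpps D m" "pivot i T c" "high_pure i T c"
  shows "e_op D m i T = Some (descent_resolution D m i (recolour i c UNIV T))"
  using pivot_high[OF rpp_finite_pure_columns] assms by (simp add: e_op_def)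

lemma f_op_eq:
  assumes "T \<in> rpps D m" "pivot i T c" "low_pure i T c"
  shows "f_op D m i T = Some (descent_resolution D m i (recolour i c {} T))"
  using pivot_low[OF rpp_finite_pure_columns] assms by (simp add: f_op_def)

text \<open>The run ends with an \<open>i\<close>-pure pivot \<open>p\<close>, so \<open>p\<close>
  is the column that \<open>f_op\<close> flips; the reversed run then restores
  \<open>T\<close>.\<close>

lemma e_op_SomeD:
  assumes T: "T \<in> rpps D m" and e: "e_op D m i T = Some T'"
  shows "T' \<in> rpps D m" "f_op D m i T' = Some T" "ebb i T' = ebb i T - 1"
    and "1 \<le> k \<Longrightarrow> wt T' k = wt T k + unit_vec i k - unit_vec (i + 1) k"
proof -
  have fin: "finite (pure_columns i T)"
    by (rule rpp_finite_pure_columns[OF T])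
  define c where "c = Min (unmatched_opening i T)"
  have "unmatched_opening i T \<noteq> {}"
    using e by (auto simp: e_op_def)
  then have c: "high_pure i T c" "pivot i T c"
    unfolding c_def using Min_unmatched_opening[OF fin] by auto
  let ?V = "recolour i c UNIV T"
  have hole: "hole T c"
    using T c by (intro hole_rpp) auto
  then have holeV: "hole ?V c"
    by (intro hole_recolour) auto
  have low: "low_pure i ?V c"
    using c by (intro low_pure_recolour) (simp add: high_pure_def)
  have restore: "recolour i c {} ?V = T"
    using c by (simp add: recolour_recolour recolour_high_pure)
  obtain p S where S: "S \<in> rpps D m" "(resolution_step D m i)\<^sup>*\<^sup>* ?V S" "hole S p" "low_pure i S p"
    "(resolution_step D m i)\<^sup>*\<^sup>* (recolour i p {} S) T"
    "height i S p = height i ?V c" "\<forall>k\<ge>1. wt S k = wt ?V k"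
    using resolve_low[OF holeV low] unfolding restore by blast
  have "T' = S"
    using e e_op_eq[OF T c(2,1)] descent_resolution_eq[OF holeV S(2,1)] by simp
  show "T' \<in> rpps D m"
    using S(1) \<open>T' = S\<close> by simp
  have pivot: "pivot i S p"
    using S(3) by (simp add: hole_def)
  have "hole (recolour i p {} S) p"
    using S(3) by (intro hole_recolour) auto
  then show "f_op D m i T' = Some T"
    using f_op_eq[OF S(1) pivot S(4)] descent_resolution_eq[OF _ S(5) T] \<open>T' = S\<close> by simp
  \<comment> \<open>Neither flip nor run changes the height at the hole. The minimum is this height
    while the hole is opening and one less once it is closing.\<close>
  have "height i ?V c = height i T c"
    using height_recolour[of c i ?V T c] by (simp add: recolour_other_column)
  then show "ebb i T' = ebb i T - 1"
    using ebb_high[OF fin c] ebb_low[OF rpp_finite_pure_columns[OF S(1)] S(4) pivot] S(6)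
    by (simp add: \<open>T' = S\<close>)
  show "wt T' k = wt T k + unit_vec i k - unit_vec (i + 1) k" if "1 \<le> k"
  proof -
    have finT: "finite {y. column_contains T y k}"
      using T that by (intro finite_columns) (auto simp: rpps_def)
    \<comment> \<open>Resolution keeps the weight, so only the flip of column \<open>c\<close> from
      \<open>i + 1\<close> to \<open>i\<close> counts.\<close>
    have "int (card {y. column_contains ?V y k}) = wt T k + unit_vec i k - unit_vec (i + 1) k"
    proof -
      consider "k = i" | "k = Suc i" | "k \<noteq> i" "k \<noteq> Suc i" by blast
      then show ?thesis
      proof cases
        case 1
        have "{y. column_contains ?V y k} = insert c {y. column_contains T y k}"
        proof (rule set_eqI)
          fix y
          show "y \<in> {y. column_contains ?V y k} \<longleftrightarrow> y \<in> insert c {y. column_contains T y k}"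
            using low 1 by (cases "y = c") (simp_all add: recolour_other_column low_pure_def)
        qed
        then show ?thesis
          using finT c 1 by (simp add: wt_def unit_vec_def high_pure_def)
      next
        case 2
        have "{y. column_contains T y k} = insert c {y. column_contains ?V y k}"
        proof (rule set_eqI)
          fix y
          show "y \<in> {y. column_contains T y k} \<longleftrightarrow> y \<in> insert c {y. column_contains ?V y k}"
            using c 2 by (cases "y = c") (simp_all add: recolour_other_column high_pure_def)
        qed
        then show ?thesis
          using finT low 2 by (simp add: wt_def unit_vec_def low_pure_def)
      next
        case 3
        then show ?thesis
          by (simp add: wt_def unit_vec_def column_contains_recolour_other)
      qed
    qed
    then show ?thesis
      using S(7) that by (simp add: \<open>T' = S\<close> wt_def)
  qed
qed

lemma f_op_SomeD:
  assumes T: "T \<in> rpps D m" and f: "f_op D m i T = Some T'"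
  shows "T' \<in> rpps D m" "e_op D m i T' = Some T"
proof -
  have fin: "finite (pure_columns i T)"
    by (rule rpp_finite_pure_columns[OF T])
  define c where "c = Max (unmatched_closing i T)"
  have "unmatched_closing i T \<noteq> {}"
    using f by (auto simp: f_op_def)
  then have c: "low_pure i T c" "pivot i T c"
    unfolding c_def using Max_unmatched_closing[OF fin] by auto
  let ?V = "recolour i c {} T"
  have hole: "hole T c"
    using T c by (intro hole_rpp) auto
  then have holeV: "hole ?V c"
    by (intro hole_recolour) auto
  have high: "high_pure i ?V c"
    using c by (intro high_pure_recolour) (simp add: low_pure_def)
  have restore: "recolour i c UNIV ?V = T"
    using c by (simp add: recolour_recolour recolour_low_pure)
  obtain p S where S: "S \<in> rpps D m" "(resolution_step D m i)\<^sup>*\<^sup>* ?V S" "hole S p" "high_pure i S p"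
    "(resolution_step D m i)\<^sup>*\<^sup>* (recolour i p UNIV S) T"
    using resolve_high[OF holeV high] unfolding restore by blast
  have "T' = S"
    using f f_op_eq[OF T c(2,1)] descent_resolution_eq[OF holeV S(2,1)] by simp
  show "T' \<in> rpps D m"
    using S(1) \<open>T' = S\<close> by simp
  have pivot: "pivot i S p"
    using S(3) by (simp add: hole_def)
  have "hole (recolour i p UNIV S) p"
    using S(3) by (intro hole_recolour) auto
  then show "e_op D m i T' = Some T"
    using e_op_eq[OF S(1) pivot S(4)] descent_resolution_eq[OF _ S(5) T] \<open>T' = S\<close> by simp
qed

lemma e_op_f_op_iff:
  "T \<in> rpps D m \<Longrightarrow> T' \<in> rpps D m \<Longrightarrow> e_op D m i T = Some T' \<longleftrightarrow> f_op D m i T' = Some T"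
  using e_op_SomeD(2) f_op_SomeD(2) by blast

section \<open>Counting iterations\<close>

lemma height_eventually_total:
  assumes "T \<in> rpps D m"
  obtains N where "\<And>c. c \<in> pure_columns i T \<Longrightarrow> c < N" "height i T N = wt T (i + 1) - wt T i"
proof -
  have "finite ({c. column_contains T c i} \<union> {c. column_contains T c (i + 1)})"
    using assms i_pos finite_columns[of T] by (simp add: rpps_def)
  then obtain N where N: "\<And>c. column_contains T c i \<Longrightarrow> c < N"
    "\<And>c. column_contains T c (i + 1) \<Longrightarrow> c < N"
    unfolding finite_nat_set_iff_bounded by blast
  then have "\<And>c. c \<in> pure_columns i T \<Longrightarrow> c < N"
    by (auto simp: pure_columns_def sign_def of_bool_def split: if_splits)
  then show thesis
    using that height_total[OF N] by blast
qed

lemma iterate_e_op: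
  assumes "T \<in> rpps D m"
  shows "{k. iterate (e_op D m i) k T \<noteq> None} = {..nat (wt T (i + 1) - wt T i - ebb i T)}"
proof (rule iterate_domain[OF _ _ assms])
  fix T T' assume T: "T \<in> rpps D m" and e: "e_op D m i T = Some T'"
  note D = e_op_SomeD[OF T e]
  obtain N where N: "height i T' N = wt T' (i + 1) - wt T' i"
    using height_eventually_total[OF D(1)] by blast
  have "ebb i T' \<le> wt T' (i + 1) - wt T' i"
    using ebb_le[OF rpp_finite_pure_columns[OF D(1)], of N] N by simp
  \<comment> \<open>From \<open>T\<close> to \<open>T'\<close> the final height falls by two and
    \<open>ebb\<close> by one. The difference for \<open>T'\<close> is not negative, so
    \<open>nat\<close> truncates nothing and the rank falls by exactly one.\<close>
  then show "T' \<in> rpps D m \<and> nat (wt T (i + 1) - wt T i - ebb i T) =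
      Suc (nat (wt T' (i + 1) - wt T' i - ebb i T'))"
    using D(1,3) D(4)[of i] D(4)[of "i + 1"] i_pos by (simp add: unit_vec_def)
next
  fix T assume T: "T \<in> rpps D m" and e: "e_op D m i T = None"
  obtain N where N: "\<And>c. c \<in> pure_columns i T \<Longrightarrow> c < N" "height i T N = wt T (i + 1) - wt T i"
    using height_eventually_total[OF T] by blast
  have "unmatched_opening i T = {}"
    using e by (simp add: e_op_def split: if_splits)
  then show "nat (wt T (i + 1) - wt T i - ebb i T) = 0"
    using ebb_no_opening[OF rpp_finite_pure_columns[OF T] _ N(1)] N(2) by simp
qed

lemma iterate_f_op:
  assumes "T \<in> rpps D m"
  shows "{k. iterate (f_op D m i) k T \<noteq> None} = {..nat (- ebb i T)}"
proof (rule iterate_domain[OF _ _ assms])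
  fix T T' assume T: "T \<in> rpps D m" and f: "f_op D m i T = Some T'"
  note D = f_op_SomeD[OF T f]
  \<comment> \<open>The initial height is 0, so \<open>nat\<close> truncates nothing; the change of
    \<open>ebb\<close> is that of \<open>e_op\<close> from \<open>T'\<close> back to
    \<open>T\<close>.\<close>
  have "ebb i T' \<le> 0"
    using ebb_le[OF rpp_finite_pure_columns[OF D(1)], of 0] by simp
  then show "T' \<in> rpps D m \<and> nat (- ebb i T) = Suc (nat (- ebb i T'))"
    using D(1) e_op_SomeD(3)[OF D] by simp
next
  fix T assume T: "T \<in> rpps D m" and f: "f_op D m i T = None"
  have "unmatched_closing i T = {}"
    using f by (simp add: f_op_def split: if_splits)
  then show "nat (- ebb i T) = 0"
    using ebb_no_closing[OF rpp_finite_pure_columns[OF T]] by simp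
qed

text \<open>The minimum \<open>ebb\<close> occurs in both counts and cancels, leaving the negative
  of the final height.\<close>

lemma max_iterate_difference:
  assumes "T \<in> rpps D m"
  shows "int (max_iterate (f_op D m i) T) - int (max_iterate (e_op D m i) T) = wt T i - wt T (i + 1)"
proof -
  have Max: "Max {..n} = n" for n :: nat
    by (rule Max_eqI) auto
  obtain N where N: "height i T N = wt T (i + 1) - wt T i"
    using height_eventually_total[OF assms] by blast
  have "ebb i T \<le> 0" "ebb i T \<le> wt T (i + 1) - wt T i"
    using ebb_le[OF rpp_finite_pure_columns[OF assms]] N by (metis height_0)+
  then show ?thesis
    by (simp add: max_iterate_def iterate_e_op[OF assms] iterate_f_op[OF assms] Max
        del: not_None_eq)
qed

end

section \<open>The diagram of a skew shape\<close>

lemma finite_boxes: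
  assumes "is_skew_shape lam mu"
  shows "finite (boxes lam mu)"
proof (rule finite_subset)
  have "lam r \<le> lam 0" for r
    using assms by (auto simp: is_skew_shape_def is_partition_def dest: antimonoD)
  then show "boxes lam mu \<subseteq> {r. lam r \<noteq> 0} \<times> {..<lam 0}"
    by (force simp: boxes_def intro: less_le_trans)
  show "finite ({r. lam r \<noteq> 0} \<times> {..<lam 0})"
    using assms by (simp add: is_skew_shape_def is_partition_def)
qed

text \<open>Monotonicity gives the chain \<open>mu x \<le> mu r \<le> c \<le> y \<le> c' < lam r'
  \<le> lam x\<close>.\<close>

lemma boxes_convex:
  assumes "is_skew_shape lam mu" "(r, c) \<in> boxes lam mu" "(r', c') \<in> boxes lam mu"
    and "r \<le> x" "x \<le> r'" "c \<le> y" "y \<le> c'"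
  shows "(x, y) \<in> boxes lam mu"
proof -
  have "mu x \<le> mu r" "lam r' \<le> lam x"
    using assms by (auto simp: is_skew_shape_def is_partition_def dest: antimonoD)
  then show ?thesis
    using assms(2-) by (simp add: boxes_def)
qed

theorem theorem1p1:
  fixes lam mu :: "nat \<Rightarrow> nat" and m :: nat
  assumes "is_skew_shape lam mu" and "m \<ge> 1"
  defines "D \<equiv> boxes lam mu"
  defines "R \<equiv> rpps D m"
  shows "\<forall>i\<in>{1..m - 1}.
     (\<forall>T\<in>R. \<forall>T'. e_op D m i T = Some T' \<longrightarrow> T' \<in> R) \<and>
     (\<forall>T\<in>R. \<forall>T'. f_op D m i T = Some T' \<longrightarrow> T' \<in> R) \<and>
     (\<forall>T\<in>R. \<forall>T'\<in>R. e_op D m i T = Some T' \<longleftrightarrow> f_op D m i T' = Some T) \<and>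
     (\<forall>T\<in>R. \<forall>T'. e_op D m i T = Some T' \<longrightarrow>
        (\<forall>k\<in>{1..m}. wt T' k = wt T k + unit_vec i k - unit_vec (i + 1) k)) \<and>
     (\<forall>T\<in>R.
        finite {k. iterate (e_op D m i) k T \<noteq> None} \<and>
        finite {k. iterate (f_op D m i) k T \<noteq> None} \<and>
        int (max_iterate (f_op D m i) T) - int (max_iterate (e_op D m i) T) = wt T i - wt T (i + 1))"
proof
  fix i assume i: "i \<in> {1..m - 1}"
  interpret convex_diagram D m i
  proof
    show "finite D"
      unfolding D_def by (rule finite_boxes[OF assms(1)])
    show "(x, y) \<in> D" if "(r, c) \<in> D" "(r', c') \<in> D" "r \<le> x" "x \<le> r'" "c \<le> y" "y \<le> c'"
      for r c r' c' x y
      using that unfolding D_def by (rule boxes_convex[OF assms(1)])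
    show "1 \<le> i" "i < m"
      using i assms(2) by auto
  qed
  show "(\<forall>T\<in>R. \<forall>T'. e_op D m i T = Some T' \<longrightarrow> T' \<in> R) \<and>
     (\<forall>T\<in>R. \<forall>T'. f_op D m i T = Some T' \<longrightarrow> T' \<in> R) \<and>
     (\<forall>T\<in>R. \<forall>T'\<in>R. e_op D m i T = Some T' \<longleftrightarrow> f_op D m i T' = Some T) \<and>
     (\<forall>T\<in>R. \<forall>T'. e_op D m i T = Some T' \<longrightarrow>
        (\<forall>k\<in>{1..m}. wt T' k = wt T k + unit_vec i k - unit_vec (i + 1) k)) \<and>
     (\<forall>T\<in>R.
        finite {k. iterate (e_op D m i) k T \<noteq> None} \<and>
        finite {k. iterate (f_op D m i) k T \<noteq> None} \<and>
        int (max_iterate (f_op D m i) T) - int (max_iterate (e_op D m i) T) = wt T i - wt T (i + 1))"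
    unfolding R_def
  proof (intro conjI ballI allI impI)
    fix T T' assume T: "T \<in> rpps D m" "e_op D m i T = Some T'"
    show "T' \<in> rpps D m"
      using e_op_SomeD(1)[OF T] .
    show "wt T' k = wt T k + unit_vec i k - unit_vec (i + 1) k" if "k \<in> {1..m}" for k
      using e_op_SomeD(4)[OF T] that by simp
  next
    fix T assume T: "T \<in> rpps D m"
    show "finite {k. iterate (e_op D m i) k T \<noteq> None}"
      unfolding iterate_e_op[OF T] by simp
    show "finite {k. iterate (f_op D m i) k T \<noteq> None}"
      unfolding iterate_f_op[OF T] by simp
    show "int (max_iterate (f_op D m i) T) - int (max_iterate (e_op D m i) T) =
        wt T i - wt T (i + 1)"
      by (rule max_iterate_difference[OF T])
  qed (use f_op_SomeD(1) e_op_f_op_iff in blast)+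
qed

end
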